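(* Let $\bm{g}=(a_p)_p$ be the greedy sequence (defined in the context). Then $\lambda(\mathcal{A}(\bm{g}))=1$. Moreover, $\mathcal{A}(\bm{g},c)=[0,1]$ for every $c>2$, whereas for all sufficiently small $c>0$, $$\dim_H([0,1]\setminus\mathcal{A}(\bm{g},c))=1.$$
   Context: The index $p$ runs over primes. $\lambda$ is Lebesgue measure on $[0,1]$ and $\dim_H$ is Hausdorff dimension. For a sequence $\bm{a}=(a_p)_p$ of integers with $0\leq a_p<p$ for all primes $p$, and $c>0$, $$\mathcal{A}(\bm{a},c)=\{x\in[0,1] : |x-a_p/p|\leq c/p \text{ for infinitely many primes } p\},\qquad \mathcal{A}(\bm{a})=\bigcap_{c>0}\mathcal{A}(\bm{a},c).$$ Greedy sequence. For a prime $p_0$, the procedure CoverOnceFrom($p_0$) is: set $x\leftarrow 0$ and let $q$ run through the consecutive primes $p_0$, next prime after $p_0$, and so on; at each prime $q$ define $a_q:=\lfloor qx\rfloor$ and then update $x\leftarrow \frac{a_q}{q}+\frac{2}{q}$; as soon as $x\geq 1$, stop (otherwise continue with the next prime). The procedure terminates for every prime $p_0$, after having defined $a_p$ for all primes $p_0\leq p\leq q$, where $q$ is the last prime used. The greedy sequence $\bm{g}$ is obtained by running CoverOnceFrom($2$), then running CoverOnceFrom($p_0'$), where $p_0'$ is the smallest prime larger than the last prime used, and iterating this indefinitely, so that $a_p$ is defined for every prime $p$. (The first ranges of primes are $\{2\}$, $\{3,5\}$, $\{7,\ldots,47\}$.) *)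

theory Defs
  imports "HOL-Analysis.Analysis" "HOL-Computational_Algebra.Primes"
begin

definition next_prime :: "nat \<Rightarrow> nat" where
  "next_prime n = (LEAST q. prime q \<and> n < q)"

definition cover_step :: "nat \<Rightarrow> real \<Rightarrow> real" where
  "cover_step q x = real_of_int \<lfloor>real q * x\<rfloor> / real q + 2 / real q"

text \<open>\<open>cover_once_from p0 q x\<close>: the procedure CoverOnceFrom, started at \<open>p0\<close>, uses the prime \<open>q\<close>,
  and \<open>x\<close> is the value of its variable just before \<open>q\<close> is treated.\<close>

inductive cover_once_from :: "nat \<Rightarrow> nat \<Rightarrow> real \<Rightarrow> bool" for p0 :: nat where
  start: "cover_once_from p0 p0 0"
| continue: "cover_once_from p0 q x \<Longrightarrow> cover_step q x < 1 \<Longrightarrow>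
    cover_once_from p0 (next_prime q) (cover_step q x)"

text \<open>The primes at which the successive runs of CoverOnceFrom begin.\<close>

inductive greedy_start :: "nat \<Rightarrow> bool" where
  first: "greedy_start 2"
| restart: "greedy_start p0 \<Longrightarrow> cover_once_from p0 q x \<Longrightarrow> cover_step q x \<ge> 1 \<Longrightarrow>
    greedy_start (next_prime q)"

text \<open>The description is meaningful at primes only, where it is justified by
  \<open>greedy_state_unique\<close> below; the value at other arguments is irrelevant.\<close>

definition greedy :: "nat \<Rightarrow> int" where
  "greedy p = (THE a. \<exists>p0 x. greedy_start p0 \<and> cover_once_from p0 p x \<and> a = \<lfloor>real p * x\<rfloor>)"

definition prime_approx :: "(nat \<Rightarrow> int) \<Rightarrow> real \<Rightarrow> real set" where
  "prime_approx a c =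
     {x \<in> {0..1}. infinite {p. prime p \<and> \<bar>x - real_of_int (a p) / real p\<bar> \<le> c / real p}}"

definition prime_approx_all :: "(nat \<Rightarrow> int) \<Rightarrow> real set" where
  "prime_approx_all a = (\<Inter>c\<in>{0<..}. prime_approx a c)"

text \<open>The \<open>s\<close>-th power of the diameter, with the usual conventions that the empty set contributes
  \<open>0\<close> and every nonempty set contributes \<open>1\<close> when \<open>s = 0\<close> (whereas \<open>0 powr 0 = 0\<close>).\<close>

definition diam_power :: "real \<Rightarrow> 'a::metric_space set \<Rightarrow> ennreal" where
  "diam_power s U =
     (if U = {} then 0 else if s = 0 then 1 else ennreal (diameter U powr s))"

text \<open>Boundedness is required explicitly because \<open>diameter\<close> is unspecified for unbounded sets.\<close>

definition hausdorff_premeasure :: "real \<Rightarrow> real \<Rightarrow> 'a::metric_space set \<Rightarrow> ennreal" where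
  "hausdorff_premeasure s \<delta> E =
     (INF U \<in> {U :: nat \<Rightarrow> 'a set. E \<subseteq> (\<Union>i. U i) \<and> (\<forall>i. bounded (U i) \<and> diameter (U i) \<le> \<delta>)}.
        \<Sum>i. diam_power s (U i))"

definition hausdorff_measure :: "real \<Rightarrow> 'a::metric_space set \<Rightarrow> ennreal" where
  "hausdorff_measure s E = (SUP \<delta> \<in> {0<..}. hausdorff_premeasure s \<delta> E)"

definition hausdorff_dim :: "'a::metric_space set \<Rightarrow> ennreal" where
  "hausdorff_dim E = (INF s \<in> {s. 0 \<le> s \<and> hausdorff_measure s E = 0}. ennreal s)"

lemma next_prime: "prime (next_prime n) \<and> n < next_prime n"
  unfolding next_prime_def by (rule LeastI_ex) (use bigger_prime in blast)

lemma next_prime_le: "prime q \<Longrightarrow> n < q \<Longrightarrow> next_prime n \<le> q"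
  unfolding next_prime_def by (rule Least_le) simp

lemma next_prime_inj: "prime q \<Longrightarrow> prime r \<Longrightarrow> next_prime q = next_prime r \<Longrightarrow> q = r"
  by (metis leD linorder_neqE_nat next_prime next_prime_le)

lemma next_prime_surj:
  assumes "prime p" "p \<noteq> 2"
  obtains q where "prime q" "q < p" "next_prime q = p"
proof -
  define A where "A = {q. prime q \<and> q < p}"
  have "2 < p" using assms prime_ge_2_nat[of p] by linarith
  then have A: "finite A" "2 \<in> A" unfolding A_def by auto
  then have M: "Max A \<in> A" using Max_in by blast
  have "next_prime (Max A) = p"
  proof (rule antisym)
    show "next_prime (Max A) \<le> p" using M assms next_prime_le A_def by auto
    show "p \<le> next_prime (Max A)"
    proof (rule ccontr)
      assume "\<not> p \<le> next_prime (Max A)"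
      then have "next_prime (Max A) \<in> A" using next_prime A_def by auto
      then show False using Max_ge[OF A(1)] next_prime leD by blast
    qed
  qed
  then show ?thesis using that M A_def by blast
qed

lemma cover_once_from_prime: "cover_once_from p0 q x \<Longrightarrow> prime p0 \<Longrightarrow> prime q"
  by (induction rule: cover_once_from.induct) (use next_prime in auto)

lemma greedy_start_prime: "greedy_start p0 \<Longrightarrow> prime p0"
  by (induction rule: greedy_start.induct) (use next_prime in auto)

lemma greedy_state_cases:
  assumes "greedy_start p0" "cover_once_from p0 p x"
  obtains "p = 2" "p0 = 2" "x = 0"
  | q r y where "prime q" "p = next_prime q" "greedy_start r" "cover_once_from r q y"
      "if cover_step q y < 1 then p0 = r \<and> x = cover_step q y else p0 = p \<and> x = 0"
  using assms(2)
proof cases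
  case start
  from assms(1) show ?thesis
  proof cases
    case first
    then show ?thesis using that(1) start by simp
  next
    case (restart r q y)
    then show ?thesis using that(2)[of q r y] start
      by (simp add: cover_once_from_prime greedy_start_prime)
  qed
next
  case (continue q y)
  then show ?thesis using that(2)[of q p0 y] assms(1)
    by (simp add: cover_once_from_prime greedy_start_prime)
qed

lemma greedy_state_unique:
  assumes "prime p"
  shows "\<exists>!(p0, x). greedy_start p0 \<and> cover_once_from p0 p x"
  using assms
proof (induction p rule: less_induct)
  case (less p)
  show ?case
  proof (cases "p = 2")
    case True
    have "p0 = 2 \<and> x = 0" if "greedy_start p0" "cover_once_from p0 2 x" for p0 x
      using that
    proof (cases rule: greedy_state_cases)
      case (2 q r y)
      then show ?thesis using next_prime[of q] prime_ge_2_nat[of q] by simp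
    qed simp
    then show ?thesis
      using True by (auto intro!: ex1I[of _ "(2, 0)"] greedy_start.first cover_once_from.start)
  next
    case False
    then obtain q where q: "prime q" "q < p" "next_prime q = p"
      using less.prems next_prime_surj by blast
    obtain r y where ry: "greedy_start r" "cover_once_from r q y"
      and uniq: "\<And>r' y'. greedy_start r' \<Longrightarrow> cover_once_from r' q y' \<Longrightarrow> r' = r \<and> y' = y"
      using less.IH[OF q(2,1)] unfolding case_prod_beta by (metis fst_conv snd_conv)
    define s where "s = (if cover_step q y < 1 then (r, cover_step q y) else (p, 0))"
    have ex: "greedy_start (fst s) \<and> cover_once_from (fst s) p (snd s)"
      using ry q(3) cover_once_from.continue[OF ry(2)] greedy_start.restart[OF ry]
      by (auto simp: s_def intro: cover_once_from.start)
    have "(p0, x) = s" if "greedy_start p0" "cover_once_from p0 p x" for p0 x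
      using that
    proof (cases rule: greedy_state_cases)
      case 1
      then show ?thesis using False by simp
    next
      case (2 q' r' y')
      then have "q' = q" using q next_prime_inj by metis
      then show ?thesis using 2 uniq[of r' y'] by (auto simp: s_def split: if_splits)
    qed
    with ex show ?thesis by (intro ex1I[of _ s]) (auto simp: case_prod_beta)
  qed
qed

lemma greedy_eq:
  assumes "greedy_start p0" "cover_once_from p0 p x"
  shows "greedy p = \<lfloor>real p * x\<rfloor>"
proof -
  have "prime p" using assms cover_once_from_prime greedy_start_prime by blast
  then have "\<exists>!s. greedy_start (fst s) \<and> cover_once_from (fst s) p (snd s)"
    using greedy_state_unique[of p] unfolding case_prod_beta by blast
  then have "p0' = p0 \<and> x' = x" if "greedy_start p0'" "cover_once_from p0' p x'" for p0' x'
    using assms that by (metis fst_conv snd_conv)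
  then show ?thesis unfolding greedy_def using assms by (intro the_equality) blast+
qed

end

theory Submission
  imports Defs "HOL-Computational_Algebra.Squarefree"
begin

text \<open>Within a run the points \<open>greedy p / p\<close> increase, and consecutive ones are at least \<open>1 / p\<close>
  apart. The sum of the reciprocals of the primes diverges, so there are infinitely many runs, each
  of them covering the unit interval by balls of radius \<open>2 / p\<close>. Shrinking the balls of a limsup
  set by a constant factor does not change its measure, by Vitali's covering theorem; this gives full
  measure for every \<open>c > 0\<close>.

  For the dimension, fix \<open>s < 1\<close> and a large base \<open>B = 2\<^sup>m\<close>. By Chebyshev's bound, the sum of \<open>1 / p\<close>
  over the primes between \<open>x\<close> and \<open>B * x\<close> tends to \<open>0\<close>, so these primes meet at most two runs.
  By the spacing of the points, for small \<open>c\<close> (independent of \<open>B\<close>) their balls of radius \<open>c / p\<close>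
  therefore meet at most half of the children of any \<open>B\<close>-adic interval of length about \<open>1 / x\<close>.
  Keeping the other half at every level yields a Cantor set that avoids almost all balls, and
  \<open>B powr s \<le> B / 2\<close> makes its \<open>s\<close>-dimensional measure positive.\<close>

section \<open>Sums of reciprocals of primes\<close>

text \<open>Such an \<open>n\<close> is determined by the set of primes of its squarefree part and
  by its square part. There are at most \<open>2 ^ N\<close> sets of primes below \<open>N\<close>,
  and the square part is at most \<open>y\<close> because its square divides
  \<open>n\<close>.\<close>

lemma card_smooth_le:
  fixes N y :: nat
  shows "card {n \<in> {1..y\<^sup>2}. \<forall>p. prime p \<and> p dvd n \<longrightarrow> p < N} \<le> 2 ^ N * y" (is "card ?S \<le> _")
proof -
  let ?f = "\<lambda>n::nat. (prime_factors (squarefree_part n), square_part n)"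
  \<comment> \<open>All multiplicities in a squarefree number are \<open>1\<close>, so its set of
    primes determines it.\<close>
  have prod: "\<Prod>(prime_factors (squarefree_part n)) = squarefree_part n" for n :: nat
  proof -
    have "squarefree_part n = (\<Prod>p\<in>prime_factors (squarefree_part n). p ^ multiplicity p (squarefree_part n))"
      by (subst prod_prime_factors) auto
    also have "\<dots> = \<Prod>(prime_factors (squarefree_part n))"
    proof (rule prod.cong)
      fix p assume p: "p \<in> prime_factors (squarefree_part n)"
      then have "multiplicity p (squarefree_part n) > 0"
        by (simp add: prime_factors_multiplicity)
      moreover have "multiplicity p (squarefree_part n) \<le> Suc 0"
        using p by (intro prime_multiplicity_squarefree_part_le_Suc_0) auto
      ultimately have "multiplicity p (squarefree_part n) = 1" by linarith
      then show "p ^ multiplicity p (squarefree_part n) = p" by simp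
    qed simp
    finally show ?thesis ..
  qed
  have "inj_on ?f ?S"
    by (rule inj_onI) (metis prod prod.inject squarefree_decompose)
  moreover have "?f ` ?S \<subseteq> Pow {..<N} \<times> {1..y}"
  proof clarify
    fix n assume n: "n \<in> {1..y\<^sup>2}" and sm: "\<forall>p. prime p \<and> p dvd n \<longrightarrow> p < N"
    have "p < N" if "p \<in> prime_factors (squarefree_part n)" for p
      using that sm squarefree_decompose[of n] by (metis dvd_mult2 in_prime_factors_iff)
    moreover have "square_part n ^ 2 \<le> n"
      using n by (intro dvd_imp_le) auto
    then have "square_part n ^ 2 \<le> y\<^sup>2" using n by (meson atLeastAtMost_iff order_trans)
    then have "square_part n \<le> y" by (simp add: power2_nat_le_eq_le)
    moreover have "square_part n \<noteq> 0" using n by simp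
    then have "square_part n \<ge> 1" by linarith
    ultimately show "prime_factors (squarefree_part n) \<in> Pow {..<N} \<and> square_part n \<in> {1..y}"
      by auto
  qed
  ultimately have "card ?S \<le> card (Pow {..<N} \<times> {1..y})"
    by (intro card_inj_on_le) auto
  then show ?thesis by (simp add: card_cartesian_product card_Pow)
qed

lemma card_multiples_le:
  fixes p x :: nat
  assumes "p > 0"
  shows "real (card {n \<in> {1..x}. p dvd n}) \<le> real x * (1 / real p)"
proof -
  have "{n \<in> {1..x}. p dvd n} \<subseteq> (*) p ` {1..x div p}"
  proof
    fix n assume "n \<in> {n \<in> {1..x}. p dvd n}"
    then obtain k where "n = p * k" "1 \<le> p * k" "p * k \<le> x" by auto
    then show "n \<in> (*) p ` {1..x div p}"
      using assms by (auto simp: less_eq_div_iff_mult_less_eq mult.commute Suc_le_eq)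
  qed
  then have "card {n \<in> {1..x}. p dvd n} \<le> card {1..x div p}"
    by (rule surj_card_le[rotated]) simp
  then have "real (card {n \<in> {1..x}. p dvd n}) \<le> real (x div p)" by simp
  also have "\<dots> \<le> real x / real p" by (rule of_nat_div_le_of_nat)
  finally show ?thesis by simp
qed

text \<open>Erdos: if the reciprocals of the primes from \<open>N\<close> on add up to less than \<open>1/2\<close>, then more than
  half of the numbers up to \<open>y\<^sup>2\<close> have all their prime factors below \<open>N\<close>; but such a number is
  a square times a product of distinct primes below \<open>N\<close>.\<close>

theorem not_summable_prime_reciprocals:
  "\<not> summable (\<lambda>p::nat. if prime p then 1 / real p else 0)" (is "\<not> summable ?f")
proof
  assume "summable ?f"
  then obtain N where N: "\<And>n. norm (sum ?f {N..<n}) < 1/2"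
    using summable_Cauchy[of ?f] by (metis half_gt_zero_iff order_refl zero_less_one)
  \<comment> \<open>With this \<open>y\<close> the bound \<open>2 ^ N * y\<close> of
    \<open>card_smooth_le\<close> is exactly half of \<open>y\<^sup>2\<close>.\<close>
  define y :: nat where "y = 2 ^ Suc N"
  define S where "S = {n \<in> {1..y\<^sup>2}. \<forall>p. prime p \<and> p dvd n \<longrightarrow> p < N}"
  define P where "P = {p \<in> {N..<Suc (y\<^sup>2)}. prime p}"
  have "{1..y\<^sup>2} \<subseteq> S \<union> (\<Union>p\<in>P. {n \<in> {1..y\<^sup>2}. p dvd n})"
  proof
    fix n assume n: "n \<in> {1..y\<^sup>2}"
    show "n \<in> S \<union> (\<Union>p\<in>P. {n \<in> {1..y\<^sup>2}. p dvd n})"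
    proof (cases "\<forall>p. prime p \<and> p dvd n \<longrightarrow> p < N")
      case False
      then obtain p where p: "prime p" "p dvd n" "N \<le> p" by (auto simp: not_less)
      then have "p \<le> n" using n by (intro dvd_imp_le) auto
      then show ?thesis using p n unfolding P_def by auto
    qed (use n S_def in auto)
  qed
  then have "card {1..y\<^sup>2} \<le> card (S \<union> (\<Union>p\<in>P. {n \<in> {1..y\<^sup>2}. p dvd n}))"
    by (intro card_mono) (auto simp: S_def P_def)
  also have "\<dots> \<le> card S + (\<Sum>p\<in>P. card {n \<in> {1..y\<^sup>2}. p dvd n})"
    by (intro order_trans[OF card_Un_le] add_mono card_UN_le) (auto simp: P_def)
  finally have "real (y\<^sup>2) \<le> real (card S) + (\<Sum>p\<in>P. real (card {n \<in> {1..y\<^sup>2}. p dvd n}))"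
    by (simp flip: of_nat_sum of_nat_add)
  also have "(\<Sum>p\<in>P. real (card {n \<in> {1..y\<^sup>2}. p dvd n})) \<le> (\<Sum>p\<in>P. real (y\<^sup>2) * (1 / real p))"
    by (intro sum_mono card_multiples_le) (auto simp: P_def prime_gt_0_nat)
  also have "\<dots> = real (y\<^sup>2) * (\<Sum>p\<in>P. 1 / real p)" by (simp only: sum_distrib_left)
  also have "(\<Sum>p\<in>P. 1 / real p) = sum ?f {N..<Suc (y\<^sup>2)}"
    unfolding P_def by (subst sum.inter_filter) auto
  also have "real (y\<^sup>2) * \<dots> < real (y\<^sup>2) * (1/2)"
  proof (rule mult_strict_left_mono)
    show "sum ?f {N..<Suc (y\<^sup>2)} < 1/2"
      by (rule le_less_trans[OF abs_ge_self N[unfolded real_norm_def]])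
  qed (simp add: y_def)
  finally have *: "real (y\<^sup>2) < real (card S) + real (y\<^sup>2) * (1/2)" by simp
  have "card S \<le> 2 ^ N * y" unfolding S_def by (rule card_smooth_le)
  then have "card S * 2 \<le> y\<^sup>2" by (simp add: y_def power2_eq_square)
  then have "real (card S * 2) \<le> real (y\<^sup>2)" by (rule of_nat_mono)
  with * show False by simp
qed

section \<open>Chebyshev's upper bound for primes in dyadic ranges\<close>

lemma prod_primes_dvd:
  fixes m :: nat
  assumes "finite A" "\<And>p. p \<in> A \<Longrightarrow> prime p" "\<And>p. p \<in> A \<Longrightarrow> p dvd m"
  shows "\<Prod>A dvd m"
  using assms
proof (induction A rule: finite_induct)
  case (insert p A)
  then have "coprime p (\<Prod>A)"
    by (intro prod_coprime_right) (metis insert_iff primes_coprime)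
  then show ?case using insert by (simp add: divides_mult)
qed simp

text \<open>With \<open>n = 2 ^ a\<close>, every prime in the range divides
  \<open>2 * n choose n\<close>, which is at most \<open>2 ^ (2 * n)\<close>, while each of these
  primes exceeds \<open>2 ^ a\<close>. Comparing exponents of \<open>2\<close> gives the
  bound.\<close>

lemma card_primes_dyadic_le:
  "a * card {p. prime p \<and> 2 ^ a < p \<and> p \<le> (2::nat) ^ Suc a} \<le> 2 * 2 ^ a" (is "a * card ?P \<le> _")
proof -
  define n :: nat where "n = 2 ^ a"
  have fin: "finite ?P" by (rule finite_subset[of _ "{..2 ^ Suc a}"]) auto
  have *: "p dvd (2 * n choose n)" if "p \<in> ?P" for p
  proof -
    have p: "prime p" "n < p" "p \<le> 2 * n" using that by (auto simp: n_def)
    have "p dvd fact (2 * n)" using p by (simp add: prime_dvd_fact_iff)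
    also have "fact (2 * n) = fact n * fact n * (2 * n choose n)"
      using binomial_fact_lemma[of n "2 * n"] by (simp add: mult_2)
    finally show ?thesis using p by (simp add: prime_dvd_mult_iff prime_dvd_fact_iff)
  qed
  have "\<Prod>?P dvd (2 * n choose n)"
    using fin * by (intro prod_primes_dvd) auto
  then have "\<Prod>?P \<le> (2 * n choose n)" by (intro dvd_imp_le) auto
  also have "\<dots> \<le> 2 ^ (2 * n)" by (rule binomial_le_pow2)
  finally have "\<Prod>?P \<le> 2 ^ (2 * n)" .
  moreover have "(2 ^ a) ^ card ?P \<le> \<Prod>?P"
    using prod_mono[of ?P "\<lambda>_. 2 ^ a" "\<lambda>p. p"] by simp
  ultimately have "(2::nat) ^ (a * card ?P) \<le> 2 ^ (2 * n)"
    by (simp add: power_mult)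
  then show ?thesis by (simp add: n_def)
qed

text \<open>Each of the \<open>m\<close> dyadic ranges from \<open>2 ^ b\<close> to
  \<open>2 ^ Suc b\<close> with \<open>a \<le> b\<close> contributes at most \<open>2 / b\<close>,
  hence at most \<open>2 / a\<close>.\<close>

lemma sum_prime_reciprocals_le:
  assumes "a > 0"
  shows "(\<Sum>p | prime p \<and> 2 ^ a < p \<and> p \<le> (2::nat) ^ (a + m). 1 / real p) \<le> 2 * real m / real a"
proof (induction m)
  case 0
  have "{p::nat. prime p \<and> 2 ^ a < p \<and> p \<le> 2 ^ a} = {}" by auto
  then show ?case by (simp only: add_0_right) simp
next
  case (Suc m)
  define b where "b = a + m"
  let ?A = "\<lambda>k l. {p::nat. prime p \<and> 2 ^ k < p \<and> p \<le> 2 ^ l}"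
  have fin: "finite (?A k l)" for k l by (rule finite_subset[of _ "{..2 ^ l}"]) auto
  have "(2::nat) ^ a \<le> 2 ^ b" "(2::nat) ^ b \<le> 2 ^ Suc b"
    by (rule power_increasing; simp add: b_def)+
  moreover have "{p. prime p \<and> u < p \<and> p \<le> w} = {p. prime p \<and> u < p \<and> p \<le> v} \<union> {p. prime p \<and> v < p \<and> p \<le> w}"
    if "u \<le> v" "v \<le> w" for u v w :: nat
    using that by auto
  ultimately have "?A a (Suc b) = ?A a b \<union> ?A b (Suc b)" by blast
  then have "(\<Sum>p\<in>?A a (Suc b). 1 / real p) = (\<Sum>p\<in>?A a b. 1 / real p) + (\<Sum>p\<in>?A b (Suc b). 1 / real p)"
    using fin by (simp only:) (rule sum.union_disjoint, auto)
  moreover have "(\<Sum>p\<in>?A b (Suc b). 1 / real p) \<le> (\<Sum>p\<in>?A b (Suc b). 1 / 2 ^ b)"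
  proof (rule sum_mono)
    fix p assume "p \<in> ?A b (Suc b)"
    then have "real (2 ^ b) \<le> real p" by (intro of_nat_mono) auto
    then show "1 / real p \<le> 1 / 2 ^ b" by (intro frac_le) auto
  qed
  moreover have "(\<Sum>p\<in>?A b (Suc b). 1 / 2 ^ b) \<le> 2 / real a"
  proof -
    have "real (a * card (?A b (Suc b))) \<le> real (2 * 2 ^ b)"
      using card_primes_dyadic_le[of b]
      by (intro of_nat_mono order_trans[OF mult_right_mono[of a b]]) (auto simp: b_def)
    then show ?thesis using assms by (simp add: field_simps)
  qed
  moreover have "2 * real (Suc m) / real a = 2 * real m / real a + 2 / real a"
    by (simp add: add_divide_distrib algebra_simps)
  ultimately show ?case using Suc.IH unfolding b_def add_Suc_right by linarith
qed

section \<open>Runs of the greedy procedure\<close>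

text \<open>The variable of CoverOnceFrom just before \<open>p\<close> is treated, well defined by
  \<open>greedy_state_unique\<close>. From here on the runs are handled through its recurrence
  \<open>greedy_pos_next_prime\<close> along all primes; a run starts where the value is
  \<open>0\<close>.\<close>

definition greedy_pos :: "nat \<Rightarrow> real" where
  "greedy_pos p = (THE x. \<exists>p0. greedy_start p0 \<and> cover_once_from p0 p x)"

lemma greedy_pos_eq:
  assumes "greedy_start p0" "cover_once_from p0 p x"
  shows "greedy_pos p = x"
proof -
  have "prime p" using assms cover_once_from_prime greedy_start_prime by blast
  from greedy_state_unique[OF this] assms show ?thesis
    unfolding greedy_pos_def by (intro the_equality) (auto 4 4)
qed

lemma greedy_pos_state:
  assumes "prime p"
  obtains p0 where "greedy_start p0" "cover_once_from p0 p (greedy_pos p)"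
  using greedy_state_unique[OF assms] greedy_pos_eq by (metis (mono_tags, lifting) case_prodE)

lemma greedy_eq_floor: "prime p \<Longrightarrow> greedy p = \<lfloor>real p * greedy_pos p\<rfloor>"
  by (meson greedy_eq greedy_pos_state)

lemma cover_step_greedy_pos:
  "prime p \<Longrightarrow> cover_step p (greedy_pos p) = real_of_int (greedy p) / real p + 2 / real p"
  by (simp add: cover_step_def greedy_eq_floor)

lemma greedy_pos_next_prime:
  assumes "prime p"
  shows "greedy_pos (next_prime p) =
    (if cover_step p (greedy_pos p) < 1 then cover_step p (greedy_pos p) else 0)"
proof -
  obtain p0 where p0: "greedy_start p0" "cover_once_from p0 p (greedy_pos p)"
    using greedy_pos_state[OF assms] .
  then show ?thesis
    using greedy_pos_eq[OF p0(1) continue[OF p0(2)]]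
      greedy_pos_eq[OF restart[OF p0] cover_once_from.start] by auto
qed

lemma greedy_pos_2: "greedy_pos 2 = 0"
  by (rule greedy_pos_eq[OF first start])

lemma greedy_div_le: "prime p \<Longrightarrow> real_of_int (greedy p) / real p \<le> greedy_pos p"
  using prime_gt_0_nat[of p] by (simp add: greedy_eq_floor field_simps)

lemma greedy_div_gt: "prime p \<Longrightarrow> greedy_pos p - 1 / real p < real_of_int (greedy p) / real p"
proof -
  assume p: "prime p"
  have "real p * greedy_pos p - 1 < real_of_int (greedy p)" using p by (simp add: greedy_eq_floor)
  then have "greedy_pos p < (real_of_int (greedy p) + 1) / real p"
    using prime_gt_0_nat[OF p] by (simp add: pos_less_divide_eq mult.commute)
  then show ?thesis by (simp add: add_divide_distrib)
qed

text \<open>Induction along consecutive primes. The premise \<open>next_prime r \<le> q\<close> of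
  the step serves hypotheses that hold only up to \<open>q\<close>, as in
  \<open>greedy_spacing\<close>.\<close>

lemma prime_induct_from [consumes 3, case_names base step]:
  assumes "prime p" "prime q" "p \<le> q"
    and "P p"
    and "\<And>r. prime r \<Longrightarrow> p \<le> r \<Longrightarrow> next_prime r \<le> q \<Longrightarrow> P r \<Longrightarrow> P (next_prime r)"
  shows "P q"
  using assms(2,3,5)
proof (induction q rule: less_induct)
  case (less q)
  show ?case
  proof (cases "q = p")
    case False
    with less.prems have "q \<noteq> 2" "p < q" using prime_ge_2_nat[OF assms(1)] by auto
    then obtain r where r: "prime r" "r < q" "next_prime r = q"
      using less.prems(1) next_prime_surj by blast
    have "p \<le> r"
      using next_prime_le[of p r] \<open>p < q\<close> r assms(1) by (metis leD not_le_imp_less)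
    moreover have "P r"
      by (rule less.IH[OF r(2,1) \<open>p \<le> r\<close>], rule less.prems(3)) (use r in simp_all)
    ultimately show ?thesis using r less.prems(3)[of r] by simp
  qed (use assms in simp)
qed

lemma greedy_pos_bounds:
  assumes "prime p"
  shows "0 \<le> greedy_pos p" "greedy_pos p < 1"
proof -
  have "0 \<le> greedy_pos p \<and> greedy_pos p < 1"
    using two_is_prime_nat assms prime_ge_2_nat[OF assms]
  proof (induction rule: prime_induct_from)
    case (step r)
    then have "0 \<le> real_of_int (greedy r)" by (simp add: greedy_eq_floor)
    then show ?case using step by (simp add: greedy_pos_next_prime cover_step_greedy_pos)
  qed (simp add: greedy_pos_2)
  then show "0 \<le> greedy_pos p" "greedy_pos p < 1" by auto
qed

text \<open>Rounding down to a multiple of \<open>1 / p\<close> costs less than \<open>1 / p\<close>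
  of the advance \<open>2 / p\<close>. This lower bound makes every run end; the upper bound in
  \<open>cover_step_greedy_pos_le\<close> makes runs long.\<close>

lemma cover_step_greedy_pos_gt:
  assumes "prime p"
  shows "greedy_pos p + 1 / real p < cover_step p (greedy_pos p)"
  using greedy_div_gt[OF assms] by (simp add: cover_step_greedy_pos assms)

lemma cover_step_greedy_pos_le:
  assumes "prime p"
  shows "cover_step p (greedy_pos p) \<le> greedy_pos p + 2 / real p"
  using greedy_div_le[OF assms] by (simp add: cover_step_greedy_pos assms)

section \<open>Termination of the runs and covering of the unit interval\<close>

lemma sum_primes_next_prime:
  assumes "p \<le> r" "prime r"
  shows "(\<Sum>u | prime u \<and> p \<le> u \<and> u < next_prime r. f u) =
    (\<Sum>u | prime u \<and> p \<le> u \<and> u < r. f u) + f r"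
proof -
  have "{u. prime u \<and> p \<le> u \<and> u < next_prime r} = insert r {u. prime u \<and> p \<le> u \<and> u < r}"
  proof -
    have "u < next_prime r \<longleftrightarrow> u \<le> r" if "prime u" for u
      using that next_prime[of r] next_prime_le[of u r] by linarith
    then show ?thesis using assms by (auto simp: le_less)
  qed
  moreover have "finite {u. prime u \<and> p \<le> u \<and> u < r}" by (rule finite_subset[of _ "{..<r}"]) auto
  ultimately show ?thesis by (simp add: add.commute)
qed

text \<open>If no run ended from \<open>N\<close> on, the variable would gain more than
  \<open>1 / u\<close> at every later prime \<open>u\<close> and yet stay below \<open>1\<close>, so
  the reciprocals of the primes would be summable.\<close>

lemma ex_cover_step_ge_1: "\<exists>p\<ge>N. prime p \<and> 1 \<le> cover_step p (greedy_pos p)"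
proof (rule ccontr)
  assume "\<not> ?thesis"
  then have no: "cover_step p (greedy_pos p) < 1" if "prime p" "N \<le> p" for p
    using that by (meson not_le_imp_less)
  obtain p where p: "prime p" "N < p" using bigger_prime by blast
  let ?S = "\<lambda>q. \<Sum>u | prime u \<and> p \<le> u \<and> u < q. 1 / real u"
  have S: "?S q \<le> greedy_pos q" if "prime q" "p \<le> q" for q
    using p(1) that
  proof (induction rule: prime_induct_from)
    case base
    have "{u. prime u \<and> p \<le> u \<and> u < p} = {}" by auto
    then show ?case using greedy_pos_bounds[OF p(1)] by (simp only: sum.empty)
  next
    case (step r)
    then have "greedy_pos (next_prime r) = cover_step r (greedy_pos r)"
      using no[of r] p by (simp add: greedy_pos_next_prime)
    then show ?case using step cover_step_greedy_pos_gt[of r] by (simp add: sum_primes_next_prime)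
  qed
  have "summable (\<lambda>u::nat. if prime u then 1 / real u else 0)"
  proof (rule summableI_nonneg_bounded)
    fix n
    obtain q where q: "prime q" "n + p < q" using bigger_prime by blast
    have "(\<Sum>u<n. if prime u then 1 / real u else 0) \<le> (\<Sum>u<q. if prime u then 1 / real u else 0)"
      using q by (intro sum_mono2) auto
    also have "\<dots> = (\<Sum>u<p. if prime u then 1 / real u else 0) + (\<Sum>u=p..<q. if prime u then 1 / real u else 0)"
      using q sum.atLeastLessThan_concat[of 0 p q "\<lambda>u. if prime u then 1 / real u else 0"]
      by (simp add: lessThan_atLeast0)
    also have "(\<Sum>u=p..<q. if prime u then 1 / real u else 0) = ?S q"
      by (subst sum.inter_filter[symmetric]) (auto intro!: sum.cong)
    also have "\<dots> \<le> 1" using S[of q] greedy_pos_bounds[of q] q by auto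
    finally show "(\<Sum>u<n. if prime u then 1 / real u else 0) \<le> (\<Sum>u<p. if prime u then 1 / real u else 0) + 1"
      by simp
  qed simp
  then show False using not_summable_prime_reciprocals by blast
qed

text \<open>A run that starts beyond \<open>N\<close> begins at or to the left of \<open>x\<close>.
  If all its balls missed \<open>x\<close>, its variable could never pass \<open>x\<close>, and the
  run would not end.\<close>

lemma ex_prime_covering:
  assumes "0 \<le> x" "x \<le> 1"
  shows "\<exists>p>N. prime p \<and> \<bar>x - real_of_int (greedy p) / real p\<bar> \<le> 2 / real p"
proof (rule ccontr)
  assume no: "\<not> ?thesis"
  obtain r where r: "r \<ge> N" "prime r" "1 \<le> cover_step r (greedy_pos r)"
    using ex_cover_step_ge_1 by blast
  define p where "p = next_prime r"
  have p: "prime p" "N < p" "greedy_pos p = 0"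
    using r next_prime[of r] by (auto simp: p_def greedy_pos_next_prime)
  \<comment> \<open>The centre lies at or to the left of \<open>greedy_pos q\<close>, hence of
    \<open>x\<close>; so a ball that misses \<open>x\<close> lies entirely to its left, and
    \<open>cover_step\<close> is its right endpoint.\<close>
  have step: "cover_step q (greedy_pos q) < x" if "prime q" "p \<le> q" "greedy_pos q \<le> x" for q
  proof -
    have "2 / real q < \<bar>x - real_of_int (greedy q) / real q\<bar>"
      using no that p by (meson le_less_trans less_le_trans linorder_not_less)
    moreover have "0 \<le> x - real_of_int (greedy q) / real q"
      using greedy_div_le[of q] that by simp
    ultimately show ?thesis using that by (simp add: cover_step_greedy_pos)
  qed
  have le: "greedy_pos q \<le> x" if "prime q" "p \<le> q" for q
    using p(1) that
  proof (induction rule: prime_induct_from)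
    case (step q)
    then show ?case using \<open>0 \<le> x\<close> \<open>\<And>q. prime q \<Longrightarrow> p \<le> q \<Longrightarrow> greedy_pos q \<le> x \<Longrightarrow> cover_step q (greedy_pos q) < x\<close>[of q]
      by (auto simp: greedy_pos_next_prime)
  qed (simp add: p \<open>0 \<le> x\<close>)
  obtain q where "q \<ge> p" "prime q" "1 \<le> cover_step q (greedy_pos q)"
    using ex_cover_step_ge_1 by blast
  then show False using step[of q] le[of q] \<open>x \<le> 1\<close> by linarith
qed

lemma prime_approx_greedy_eq_unit_interval:
  assumes "2 \<le> c"
  shows "prime_approx greedy c = {0..1}"
proof -
  have "infinite {p. prime p \<and> \<bar>x - real_of_int (greedy p) / real p\<bar> \<le> c / real p}"
    if x: "x \<in> {0..1}" for x
    unfolding infinite_nat_iff_unbounded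
  proof
    fix N
    obtain p where p: "p > N" "prime p" "\<bar>x - real_of_int (greedy p) / real p\<bar> \<le> 2 / real p"
      using ex_prime_covering[of x N] x by auto
    moreover have "2 / real p \<le> c / real p" using assms by (simp add: divide_right_mono)
    ultimately show "\<exists>p>N. p \<in> {p. prime p \<and> \<bar>x - real_of_int (greedy p) / real p\<bar> \<le> c / real p}"
      by (intro exI[of _ p]) auto
  qed
  then show ?thesis by (auto simp: prime_approx_def)
qed

text \<open>Without a restart the variable moves to exactly \<open>2 / r\<close> beyond the point of
  \<open>r\<close>, and rounding at the next prime \<open>s\<close> takes back less than
  \<open>1 / s\<close>, which is at most \<open>1 / r\<close>.\<close>

lemma greedy_spacing:
  assumes "prime p" "prime q" "p < q"
    and no: "\<And>u. prime u \<Longrightarrow> p < u \<Longrightarrow> u \<le> q \<Longrightarrow> greedy_pos u \<noteq> 0"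
  shows "real_of_int (greedy p) / real p + 1 / real p \<le> real_of_int (greedy q) / real q"
proof -
  have step: "real_of_int (greedy r) / real r + 1 / real r \<le>
      real_of_int (greedy (next_prime r)) / real (next_prime r)"
    if r: "prime r" "p \<le> r" "next_prime r \<le> q" for r
  proof -
    let ?s = "next_prime r"
    have s: "prime ?s" "r < ?s" using next_prime by auto
    then have "greedy_pos ?s = real_of_int (greedy r) / real r + 2 / real r"
      using no[of ?s] r by (auto simp: greedy_pos_next_prime cover_step_greedy_pos split: if_splits)
    moreover have "1 / real ?s \<le> 1 / real r" using s prime_gt_0_nat[OF r(1)] by (intro frac_le) auto
    moreover have "2 / real r = 1 / real r + 1 / real r" by simp
    ultimately show ?thesis using greedy_div_gt[OF s(1)] by linarith
  qed
  have "q = p \<or> real_of_int (greedy p) / real p + 1 / real p \<le> real_of_int (greedy q) / real q"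
    using assms(1,2) less_imp_le[OF assms(3)]
  proof (induction rule: prime_induct_from)
    case (step r)
    have "real_of_int (greedy p) / real p + 1 / real p \<le> real_of_int (greedy r) / real r + 1 / real r"
      using step(4) by (auto intro: add_increasing2)
    also note \<open>\<And>r. prime r \<Longrightarrow> p \<le> r \<Longrightarrow> next_prime r \<le> q \<Longrightarrow> _\<close>[OF step(1-3)]
    finally show ?case by simp
  qed simp
  then show ?thesis using assms(3) by simp
qed

text \<open>Each prime \<open>u\<close> advances the variable by at most \<open>2 / u\<close>, and a
  restart requires it to have gone from \<open>0\<close> to at least \<open>1\<close>.\<close>

lemma sum_between_restarts:
  assumes "prime p" "prime q" "p < q" "greedy_pos p = 0" "greedy_pos q = 0"
  shows "1 \<le> (\<Sum>u | prime u \<and> p \<le> u \<and> u < q. 2 / real u)"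
proof -
  let ?S = "\<lambda>q. \<Sum>u | prime u \<and> p \<le> u \<and> u < q. 2 / real u"
  have "greedy_pos q \<le> ?S q \<and> (p < q \<and> greedy_pos q = 0 \<longrightarrow> 1 \<le> ?S q)"
    using assms(1,2) less_imp_le[OF assms(3)]
  proof (induction rule: prime_induct_from)
    case base
    show ?case using assms by (simp add: sum_nonneg)
  next
    case (step r)
    have "0 \<le> ?S (next_prime r)" by (simp add: sum_nonneg)
    moreover have "cover_step r (greedy_pos r) \<le> ?S (next_prime r)"
      using step cover_step_greedy_pos_le[of r] by (simp add: sum_primes_next_prime)
    \<comment> \<open>Hence the value \<open>0\<close> at the next prime can only come from a
      restart, where \<open>cover_step\<close> has reached \<open>1\<close>.\<close>
    moreover have "0 < cover_step r (greedy_pos r)"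
      using greedy_pos_bounds(1)[OF step(1)]
      by (intro le_less_trans[OF _ cover_step_greedy_pos_gt[OF step(1)]]) simp
    ultimately show ?case using step(1) by (auto simp: greedy_pos_next_prime)
  qed
  then show ?thesis using assms by simp
qed

section \<open>Full measure\<close>

text \<open>Almost all of \<open>S\<close> is covered by disjoint balls inside an open set that is hardly larger than
  \<open>S\<close>; the concentric balls of \<open>\<theta>\<close> times the radius fill a fixed proportion of them and
  lie in the small rest of the open set.\<close>

lemma negligible_shrunk_balls:
  fixes S :: "real set" and z r :: "'i \<Rightarrow> real"
  assumes S: "S \<in> lmeasurable" and \<theta>: "0 < \<theta>" "\<theta> \<le> 1"
    and r: "\<And>i. i \<in> I \<Longrightarrow> 0 < r i"
    and cover: "\<And>x d. x \<in> S \<Longrightarrow> 0 < d \<Longrightarrow> \<exists>i\<in>I. x \<in> cball (z i) (r i) \<and> r i < d"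
    and disj: "\<And>i. i \<in> I \<Longrightarrow> S \<inter> cball (z i) (\<theta> * r i) = {}"
  shows "negligible S"
proof -
  have "measure lebesgue S \<le> e" if e: "e > 0" for e
  proof -
    \<comment> \<open>The excess of \<open>U\<close> over \<open>S\<close> has to hold the shrunk
      balls, whose total length is at least \<open>\<theta>\<close> times the measure of
      \<open>S\<close>; the bound \<open>\<theta> * e\<close> thus yields \<open>e\<close> for
      \<open>S\<close>.\<close>
    obtain U where U: "open U" "S \<subseteq> U" "U - S \<in> lmeasurable" "emeasure lebesgue (U - S) < ennreal (\<theta> * e)"
      using sets_lebesgue_outer_open[of S "\<theta> * e"] S \<theta> e by auto
    define K where "K = {i \<in> I. cball (z i) (r i) \<subseteq> U}"
    have K: "\<exists>i. i \<in> K \<and> x \<in> cball (z i) (r i) \<and> r i < d" if xd: "x \<in> S" "0 < d" for x d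
    proof -
      obtain \<epsilon> where \<epsilon>: "\<epsilon> > 0" "cball x \<epsilon> \<subseteq> U" using U(1,2) xd(1) open_contains_cball by (metis subsetD)
      obtain i where i: "i \<in> I" "x \<in> cball (z i) (r i)" "r i < min d (\<epsilon> / 2)"
        using cover[of x "min d (\<epsilon> / 2)"] xd \<epsilon> by auto
      then have "cball (z i) (r i) \<subseteq> cball x \<epsilon>" by (auto simp: dist_real_def)
      then show ?thesis using i \<epsilon> by (auto simp: K_def)
    qed
    obtain C where C: "countable C" "C \<subseteq> K"
      "pairwise (\<lambda>i j. disjnt (cball (z i) (r i)) (cball (z j) (r j))) C"
      "negligible (S - (\<Union>i \<in> C. cball (z i) (r i)))"
      using Vitali_covering_theorem_cballs[of K r S z, OF _ K] r by (auto simp: K_def)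
    have rC: "0 < r i" if "i \<in> C" for i using C r that by (auto simp: K_def)
    have dis: "disjoint_family_on (\<lambda>i. cball (z i) (t * r i)) C" if "0 \<le> t" "t \<le> 1" for t
      unfolding disjoint_family_on_def
    proof clarify
      fix i j assume ij: "i \<in> C" "j \<in> C" "i \<noteq> j"
      have "cball (z k) (t * r k) \<subseteq> cball (z k) (r k)" if "k \<in> C" for k
        using rC[OF that] \<open>t \<le> 1\<close> by (intro cball_subset_cball_iff[THEN iffD2]) (auto simp: mult_left_le_one_le \<open>0 \<le> t\<close>)
      moreover have "disjnt (cball (z i) (r i)) (cball (z j) (r j))" using C(3) ij by (auto simp: pairwise_def)
      ultimately show "cball (z i) (t * r i) \<inter> cball (z j) (t * r j) = {}"
        using ij unfolding disjnt_def by blast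
    qed
    \<comment> \<open>Used at \<open>t = 1\<close> and at \<open>t = \<theta>\<close>, this shows
      that the shrunk balls fill exactly the proportion \<open>\<theta>\<close> of the disjoint
      covering balls.\<close>
    have em: "emeasure lebesgue (\<Union>i\<in>C. cball (z i) (t * r i)) = ennreal t * (\<integral>\<^sup>+i. ennreal (2 * r i) \<partial>count_space C)"
      if "0 \<le> t" "t \<le> 1" for t
    proof -
      have "emeasure lebesgue (\<Union>i\<in>C. cball (z i) (t * r i))
          = (\<integral>\<^sup>+i. emeasure lebesgue (cball (z i) (t * r i)) \<partial>count_space C)"
        using C(1) dis[OF that] by (intro emeasure_UN_countable) auto
      also have "\<dots> = (\<integral>\<^sup>+i. ennreal t * ennreal (2 * r i) \<partial>count_space C)"
      proof (rule nn_integral_cong)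
        fix i assume "i \<in> space (count_space C)"
        then have "0 < r i" using rC by simp
        then show "emeasure lebesgue (cball (z i) (t * r i)) = ennreal t * ennreal (2 * r i)"
          using that by (simp add: cball_eq_atLeastAtMost flip: ennreal_mult)
      qed
      finally show ?thesis by (simp add: nn_integral_cmult)
    qed
    have "emeasure lebesgue S \<le> emeasure lebesgue ((S - (\<Union>i\<in>C. cball (z i) (r i))) \<union> (\<Union>i\<in>C. cball (z i) (1 * r i)))"
      using C(1) fmeasurableD[OF S] by (intro emeasure_mono sets.Un sets.Diff sets.countable_UN'') auto
    also have "\<dots> \<le> emeasure lebesgue (S - (\<Union>i\<in>C. cball (z i) (r i))) + emeasure lebesgue (\<Union>i\<in>C. cball (z i) (1 * r i))"
      using C by (intro emeasure_subadditive) (auto simp: negligible_imp_sets)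
    also have "emeasure lebesgue (S - (\<Union>i\<in>C. cball (z i) (r i))) = 0"
      using C(4) unfolding negligible_iff_null_sets by (rule null_setsD1)
    finally have "ennreal \<theta> * emeasure lebesgue S \<le> ennreal \<theta> * emeasure lebesgue (\<Union>i\<in>C. cball (z i) (1 * r i))"
      by (intro mult_left_mono) auto
    also have "\<dots> = emeasure lebesgue (\<Union>i\<in>C. cball (z i) (\<theta> * r i))"
      using \<theta> by (simp only: em) (simp add: em)
    also have "\<dots> \<le> emeasure lebesgue (U - S)"
    proof (rule emeasure_mono)
      show "(\<Union>i\<in>C. cball (z i) (\<theta> * r i)) \<subseteq> U - S"
      proof clarify
        fix i x assume i: "i \<in> C" and x: "x \<in> cball (z i) (\<theta> * r i)"
        have "\<theta> * r i \<le> r i" using \<theta> rC[OF i] by (simp add: mult_left_le_one_le)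
        then have "x \<in> cball (z i) (r i)" using x by auto
        moreover have "i \<in> I" "cball (z i) (r i) \<subseteq> U" using i C(2) by (auto simp: K_def)
        ultimately show "x \<in> U - S" using x disj by blast
      qed
    qed (use U in auto)
    also have "\<dots> < ennreal (\<theta> * e)" by (rule U)
    finally have "ennreal (\<theta> * measure lebesgue S) < ennreal (\<theta> * e)"
      using S \<theta> by (simp add: emeasure_eq_measure2 ennreal_mult)
    then show ?thesis using \<theta> e by (simp add: ennreal_less_iff)
  qed
  from this[of "measure lebesgue S / 2"] have "measure lebesgue S = 0"
    using measure_nonneg[of lebesgue S] by linarith
  then show ?thesis using S by (simp add: negligible_iff_measure)
qed

text \<open>An exceptional point avoids, for some \<open>N\<close>, all balls of radius
  \<open>c / p\<close> with \<open>p > N\<close>. These are the balls of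
  \<open>ex_prime_covering\<close> shrunk by the factor \<open>c / 2\<close>, so
  \<open>negligible_shrunk_balls\<close> applies for each \<open>N\<close>.\<close>

lemma negligible_Diff_prime_approx_greedy:
  assumes "0 < c"
  shows "negligible ({0..1} - prime_approx greedy c)"
proof (cases "c \<le> 2")
  case True
  define I where "I N = {p. prime p \<and> N < p}" for N :: nat
  define z r :: "nat \<Rightarrow> real" where "z p = real_of_int (greedy p) / real p" and "r p = 2 / real p" for p
  define S where "S N = {0..1} - (\<Union>p\<in>I N. cball (z p) (c / 2 * r p))" for N
  have "negligible (S N)" for N
  proof (rule negligible_shrunk_balls)
    have "S N \<in> sets lebesgue"
      unfolding S_def by (intro sets.Diff sets.countable_UN'') auto
    moreover have "bounded (S N)"
      by (rule bounded_subset[of "{0..1}"]) (auto simp: S_def)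
    ultimately show "S N \<in> lmeasurable"
      by (intro bounded_set_imp_lmeasurable)
    show "0 < c / 2" "c / 2 \<le> 1" using True assms by auto
    show "0 < r p" if "p \<in> I N" for p
      using that prime_gt_0_nat by (auto simp: r_def I_def)
    show "\<exists>p\<in>I N. x \<in> cball (z p) (r p) \<and> r p < d" if x: "x \<in> S N" and d: "0 < d" for x d
    proof -
      obtain M :: nat where M: "2 / d < real M" using reals_Archimedean2 by blast
      obtain p where p: "p > max M N" "prime p" "\<bar>x - z p\<bar> \<le> r p"
        using ex_prime_covering[of x "max M N"] x by (auto simp: S_def z_def r_def)
      have "2 / d < real p" using M p by linarith
      then have "2 < real p * d" using d by (simp add: pos_divide_less_eq)
      then have "r p < d" using prime_gt_0_nat[OF p(2)] by (simp add: r_def pos_divide_less_eq mult.commute)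
      then show ?thesis using p by (intro bexI[of _ p]) (auto simp: I_def dist_real_def abs_minus_commute)
    qed
    show "S N \<inter> cball (z p) (c / 2 * r p) = {}" if "p \<in> I N" for p
      using that by (auto simp: S_def)
  qed
  then have "negligible (\<Union>N. S N)" by (intro negligible_countable_Union) auto
  moreover have "{0..1} - prime_approx greedy c \<subseteq> (\<Union>N. S N)"
  proof
    fix x assume x: "x \<in> {0..1} - prime_approx greedy c"
    then have "finite {p. prime p \<and> \<bar>x - z p\<bar> \<le> c / real p}"
      by (auto simp: prime_approx_def z_def)
    then obtain N where N: "\<And>p. prime p \<Longrightarrow> \<bar>x - z p\<bar> \<le> c / real p \<Longrightarrow> p \<le> N"
      unfolding finite_nat_set_iff_bounded_le by auto
    have "x \<notin> cball (z p) (c / 2 * r p)" if "p \<in> I N" for p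
    proof -
      have "\<not> \<bar>x - z p\<bar> \<le> c / real p" using N[of p] that by (auto simp: I_def)
      then show ?thesis by (simp add: r_def dist_real_def abs_minus_commute)
    qed
    then have "x \<in> S N" using x unfolding S_def by blast
    then show "x \<in> (\<Union>N. S N)" by blast
  qed
  ultimately show ?thesis by (rule negligible_subset)
qed (simp add: prime_approx_greedy_eq_unit_interval)

text \<open>The sets grow with \<open>c\<close>, so the values \<open>1 / (n + 1)\<close> suffice
  and the exceptional set is a countable union of negligible sets.\<close>

lemma emeasure_prime_approx_all_greedy:
  "emeasure (lebesgue_on {0..1}) (prime_approx_all greedy) = 1"
proof -
  define E where "E = {0..1} - prime_approx_all greedy"
  have "prime_approx_all greedy = (\<Inter>n. prime_approx greedy (1 / real (Suc n)))"
  proof (intro antisym subsetI)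
    fix x assume x: "x \<in> (\<Inter>n. prime_approx greedy (1 / real (Suc n)))"
    have "x \<in> prime_approx greedy c" if c: "0 < c" for c
    proof -
      obtain n where n: "1 / real (Suc n) < c"
        using c reals_Archimedean[of c] by (auto simp: inverse_eq_divide)
      have "{p. prime p \<and> \<bar>x - real_of_int (greedy p) / real p\<bar> \<le> 1 / real (Suc n) / real p}
          \<subseteq> {p. prime p \<and> \<bar>x - real_of_int (greedy p) / real p\<bar> \<le> c / real p}"
        using order_trans[OF _ divide_right_mono[OF less_imp_le[OF n]]] by auto
      moreover have "x \<in> prime_approx greedy (1 / real (Suc n))" using x by blast
      ultimately show ?thesis
        unfolding prime_approx_def mem_Collect_eq by (meson infinite_super)
    qed
    then show "x \<in> prime_approx_all greedy" by (auto simp: prime_approx_all_def)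
  qed (auto simp: prime_approx_all_def)
  then have "E = (\<Union>n. {0..1} - prime_approx greedy (1 / real (Suc n)))"
    by (auto simp: E_def)
  moreover have "negligible (\<Union>n. {0..1} - prime_approx greedy (1 / real (Suc n)))"
    by (rule negligible_countable_Union) (auto intro!: negligible_Diff_prime_approx_greedy)
  ultimately have "negligible E" by simp
  moreover have "prime_approx_all greedy = {0..1} - E"
    by (auto simp: E_def prime_approx_all_def prime_approx_def intro!: exI[of _ 1] zero_less_one)
  ultimately show ?thesis
    by (simp add: emeasure_restrict_space negligible_iff_null_sets emeasure_Diff_null_set)
qed

section \<open>Hausdorff measure and Cantor sets\<close>

text \<open>Mass distribution principle for Lebesgue measure carried over by \<open>f\<close>: the
  preimage of a covering set \<open>V\<close> lies in an interval of length
  \<open>2 * C * diameter V powr s\<close>. These intervals cover \<open>{0..<1}\<close>, so any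
  cover has sum at least \<open>1 / (2 * C)\<close>.\<close>

lemma hausdorff_measure_pos:
  fixes f :: "real \<Rightarrow> 'a::metric_space"
  assumes "0 < s" "0 < C" and E: "f ` {0..<1} \<subseteq> E"
    and hoelder: "\<And>t u. t \<in> {0..<1} \<Longrightarrow> u \<in> {0..<1} \<Longrightarrow> \<bar>t - u\<bar> \<le> C * dist (f t) (f u) powr s"
  shows "0 < hausdorff_measure s E"
proof -
  have "0 < ennreal (1 / (2 * C))" using assms(2) by simp
  also have "ennreal (1 / (2 * C)) \<le> hausdorff_premeasure s 1 E"
    unfolding hausdorff_premeasure_def
  proof (rule INF_greatest)
    fix U :: "nat \<Rightarrow> 'a set"
    assume "U \<in> {U. E \<subseteq> (\<Union>i. U i) \<and> (\<forall>i. bounded (U i) \<and> diameter (U i) \<le> 1)}"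
    then have U: "E \<subseteq> (\<Union>i. U i)" "\<And>i. bounded (U i)" by auto
    \<comment> \<open>For an arbitrary cover the preimage may fail to be measurable, so it is
      enclosed in an interval.\<close>
    have "\<exists>W. {t \<in> {0..<1}. f t \<in> U i} \<subseteq> W \<and> W \<in> sets lborel \<and>
        emeasure lborel W \<le> ennreal (2 * C) * diam_power s (U i)" for i
    proof (cases "{t \<in> {0..<1}. f t \<in> U i} = {}")
      case False
      then obtain t where t: "t \<in> {0..<1}" "f t \<in> U i" by blast
      define R where "R = C * diameter (U i) powr s"
      have "0 \<le> R" using assms(2) by (simp add: R_def)
      have "\<bar>t - u\<bar> \<le> R" if "u \<in> {0..<1}" "f u \<in> U i" for u
      proof -
        have "dist (f t) (f u) powr s \<le> diameter (U i) powr s"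
          using assms(1) diameter_bounded_bound[OF U(2) t(2) that(2)] by (intro powr_mono2) auto
        then have "C * dist (f t) (f u) powr s \<le> R"
          using assms(2) unfolding R_def by (intro mult_left_mono) auto
        with hoelder[OF t(1) that(1)] show ?thesis by (rule order_trans)
      qed
      then have "{t \<in> {0..<1}. f t \<in> U i} \<subseteq> {t - R..t + R}"
        by (force simp: abs_le_iff)
      moreover have "emeasure lborel {t - R..t + R} = ennreal (2 * C) * diam_power s (U i)"
        using \<open>0 \<le> R\<close> t(2) assms(1,2) by (auto simp: diam_power_def R_def simp flip: ennreal_mult)
      ultimately show ?thesis by (intro exI[of _ "{t - R..t + R}"]) auto
    qed (auto intro: exI[of _ "{}"])
    then obtain W where W: "\<And>i. {t \<in> {0..<1}. f t \<in> U i} \<subseteq> W i" "\<And>i. W i \<in> sets lborel"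
      "\<And>i. emeasure lborel (W i) \<le> ennreal (2 * C) * diam_power s (U i)"
      by metis
    have "{0..<1::real} \<subseteq> (\<Union>i. W i)"
    proof
      fix t :: real assume t: "t \<in> {0..<1}"
      then have "f t \<in> E" using E by (simp add: image_subset_iff)
      then have "f t \<in> (\<Union>i. U i)" by (rule subsetD[OF U(1)])
      then obtain i where "f t \<in> U i" by blast
      then have "t \<in> W i" using W(1)[of i] t by auto
      then show "t \<in> (\<Union>i. W i)" by blast
    qed
    then have "emeasure lborel {0..<1::real} \<le> emeasure lborel (\<Union>i. W i)"
      using W(2) by (intro emeasure_mono) auto
    also have "\<dots> \<le> (\<Sum>i. emeasure lborel (W i))"
      using W(2) by (intro emeasure_subadditive_countably) auto
    also have "\<dots> \<le> (\<Sum>i. ennreal (2 * C) * diam_power s (U i))"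
      using W(3) by (intro suminf_le) auto
    finally have "1 \<le> ennreal (2 * C) * (\<Sum>i. diam_power s (U i))" by simp
    then have "ennreal (1 / (2 * C)) * 1 \<le> ennreal (1 / (2 * C)) * (ennreal (2 * C) * (\<Sum>i. diam_power s (U i)))"
      by (intro mult_left_mono) auto
    also have "\<dots> = (ennreal (1 / (2 * C)) * ennreal (2 * C)) * (\<Sum>i. diam_power s (U i))"
      by (simp only: mult.assoc)
    also have "ennreal (1 / (2 * C)) * ennreal (2 * C) = 1"
      using assms(2) by (simp flip: ennreal_mult)
    finally show "ennreal (1 / (2 * C)) \<le> (\<Sum>i. diam_power s (U i))" by simp
  qed
  also have "\<dots> \<le> hausdorff_measure s E"
    unfolding hausdorff_measure_def by (intro SUP_upper) auto
  finally show ?thesis .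
qed

text \<open>The cover by \<open>N\<close> intervals of length \<open>1 / N\<close>, continued by
  empty sets, has sum \<open>N powr (1 - s)\<close>, which tends to \<open>0\<close>.\<close>

lemma hausdorff_measure_unit_interval:
  assumes "1 < s" "E \<subseteq> {0..1::real}"
  shows "hausdorff_measure s E = 0"
proof -
  have "hausdorff_premeasure s \<delta> E \<le> 0" if "0 < \<delta>" for \<delta>
  proof (rule tendsto_lowerbound)
    have "(\<lambda>N. real N powr (1 - s)) \<longlonglongrightarrow> 0"
      using assms(1) by (intro tendsto_neg_powr filterlim_real_sequentially) auto
    then show "(\<lambda>N. ennreal (real N powr (1 - s))) \<longlonglongrightarrow> 0"
      using tendsto_ennrealI by fastforce
    show "\<forall>\<^sub>F N in sequentially. hausdorff_premeasure s \<delta> E \<le> ennreal (real N powr (1 - s))"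
      using eventually_gt_at_top[of "nat \<lceil>1 / \<delta>\<rceil>"]
    proof eventually_elim
      case (elim N)
      then have N: "0 < N" "1 / \<delta> < real N" by linarith+
      then have le: "1 / real N \<le> \<delta>" using that by (simp add: field_simps)
      define U where "U i = (if i < N then {real i / real N..(real i + 1) / real N} else {})" for i
      have diam: "diameter {real i / real N..(real i + 1) / real N} = 1 / real N" for i
        using N(1) by (subst diameter_closed_interval) (auto simp: field_simps)
      have "E \<subseteq> (\<Union>i. U i)"
      proof
        fix x assume "x \<in> E"
        then have x: "0 \<le> x" "x \<le> 1" using assms(2) by auto
        \<comment> \<open>The point \<open>1\<close> is put into the last cell; the floor would give
          the index \<open>N\<close>.\<close>
        define i where "i = (if x = 1 then N - 1 else nat \<lfloor>real N * x\<rfloor>)"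
        have "i < N \<and> real i / real N \<le> x \<and> x \<le> (real i + 1) / real N"
        proof (cases "x = 1")
          case False
          then have "real N * x < real N" using x N by simp
          then have "i < N" using False x by (simp add: i_def nat_less_iff floor_less_iff)
          moreover have "real i = of_int \<lfloor>real N * x\<rfloor>" using False x by (simp add: i_def)
          then have "real i \<le> real N * x" "real N * x \<le> real i + 1" by linarith+
          ultimately show ?thesis using N by (simp add: field_simps)
        qed (use N in \<open>auto simp: i_def field_simps\<close>)
        then show "x \<in> (\<Union>i. U i)" by (intro UN_I[of i]) (auto simp: U_def)
      qed
      moreover have "bounded (U i) \<and> diameter (U i) \<le> \<delta>" for i
        using le that diam by (auto simp: U_def)
      ultimately have "hausdorff_premeasure s \<delta> E \<le> (\<Sum>i. diam_power s (U i))"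
        unfolding hausdorff_premeasure_def by (intro INF_lower) auto
      also have "\<dots> = (\<Sum>i<N. diam_power s (U i))"
        by (rule suminf_finite) (auto simp: U_def diam_power_def)
      also have "\<dots> = (\<Sum>i<N. ennreal ((1 / real N) powr s))"
        using assms(1) diam by (intro sum.cong) (auto simp: U_def diam_power_def divide_right_mono)
      also have "\<dots> = ennreal (real N * (1 / real N) powr s)"
        by (simp add: ennreal_of_nat_eq_real_of_nat flip: ennreal_mult)
      also have "real N * (1 / real N) powr s = real N powr (1 - s)"
        using N(1) by (simp add: powr_diff powr_divide)
      finally show ?case .
    qed
  qed simp
  then show ?thesis by (auto simp: hausdorff_measure_def intro!: antisym SUP_least)
qed

lemma hausdorff_dim_eq_1:
  fixes E :: "real set"
  assumes E: "E \<subseteq> {0..1}" "E \<noteq> {}"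
    and pos: "\<And>s. 0 < s \<Longrightarrow> s < 1 \<Longrightarrow> 0 < hausdorff_measure s E"
  shows "hausdorff_dim E = 1"
proof (rule antisym)
  show "hausdorff_dim E \<le> 1"
  proof (rule ccontr)
    assume "\<not> hausdorff_dim E \<le> 1"
    then obtain y where y: "1 < y" "y < hausdorff_dim E" using dense not_le by metis
    then obtain s where s: "y = ennreal s" "0 \<le> s" by (cases y) auto
    have "hausdorff_measure s E = 0"
      using y(1) s E(1) by (intro hausdorff_measure_unit_interval) (auto simp: ennreal_less_iff simp flip: ennreal_1)
    then have "hausdorff_dim E \<le> ennreal s"
      unfolding hausdorff_dim_def using s by (intro INF_lower) auto
    then show False using y s by auto
  qed
  \<comment> \<open>The infimum also ranges over \<open>s = 0\<close>, which \<open>pos\<close>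
    leaves out. There a nonempty member of the cover contributes \<open>1\<close>.\<close>
  have "0 < hausdorff_measure 0 E"
  proof -
    have "1 \<le> hausdorff_premeasure 0 1 E"
      unfolding hausdorff_premeasure_def
    proof (rule INF_greatest)
      fix U :: "nat \<Rightarrow> real set"
      assume "U \<in> {U. E \<subseteq> (\<Union>i. U i) \<and> (\<forall>i. bounded (U i) \<and> diameter (U i) \<le> 1)}"
      moreover obtain x where "x \<in> E" using E(2) by blast
      ultimately obtain i where "U i \<noteq> {}" by blast
      then have "1 = (\<Sum>i\<in>{i}. diam_power 0 (U i))" by (simp add: diam_power_def)
      also have "\<dots> \<le> (\<Sum>i. diam_power 0 (U i))" by (intro sum_le_suminf) auto
      finally show "1 \<le> (\<Sum>i. diam_power 0 (U i))" .
    qed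
    also have "\<dots> \<le> hausdorff_measure 0 E"
      unfolding hausdorff_measure_def by (intro SUP_upper) auto
    finally show ?thesis using less_le_trans zero_less_one by blast
  qed
  then have "1 \<le> s" if "0 \<le> s" "hausdorff_measure s E = 0" for s
    using that pos[of s] by (cases "s = 0"; cases "s < 1") auto
  then show "1 \<le> hausdorff_dim E"
    unfolding hausdorff_dim_def by (intro INF_greatest) (auto simp: ennreal_le_iff simp flip: ennreal_1)
qed

text \<open>An address \<open>i < M ^ n\<close> has \<open>n\<close> digits in base
  \<open>M\<close>: \<open>i div M\<close> is the address of the parent, and the last digit
  \<open>i mod M\<close> selects one of its children through \<open>\<sigma>\<close>. The value is
  the number of an interval of level \<open>n\<close>, counted from the left.\<close>

primrec cantor_index :: "nat \<Rightarrow> (nat \<Rightarrow> nat \<Rightarrow> nat \<Rightarrow> nat) \<Rightarrow> nat \<Rightarrow> nat \<Rightarrow> nat" where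
  "cantor_index M \<sigma> 0 i = 0"
| "cantor_index M \<sigma> (Suc n) i = \<sigma> n (cantor_index M \<sigma> n (i div M)) (i mod M)"

text \<open>The \<open>M\<close>-adic expansion of \<open>t\<close> is read as the address of a point in a tree of
  \<open>B\<close>-adic intervals in which every vertex keeps at least \<open>M\<close> of its \<open>B\<close> children.\<close>

lemma cantor_tree_hoelder:
  fixes B M :: nat and s :: real and G :: "nat \<Rightarrow> nat \<Rightarrow> bool"
  assumes B: "2 \<le> B" and s: "0 < s" "real B powr s \<le> real M"
    and G: "\<And>n j. M \<le> card {k \<in> {B * j..<B * Suc j}. G (Suc n) k}"
  obtains f :: "real \<Rightarrow> real" where
    "\<And>t n. t \<in> {0..<1} \<Longrightarrow> \<exists>k. G (Suc n) k \<and> f t \<in> {real k / real B ^ Suc n..real (Suc k) / real B ^ Suc n}"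
    "\<And>t. t \<in> {0..<1} \<Longrightarrow> f t \<in> {0..1}"
    "\<And>t u. t \<in> {0..<1} \<Longrightarrow> u \<in> {0..<1} \<Longrightarrow> \<bar>t - u\<bar> \<le> 3 * real M * \<bar>f t - f u\<bar> powr s"
proof -
  have "1 < real B powr s" using B s(1) by (intro gr_one_powr) auto
  then have M: "1 < M" using s(2) by linarith
  \<comment> \<open>Listing the kept children in increasing order makes \<open>cantor_index\<close>
    increasing in the address, so that gaps between addresses carry over to the intervals.\<close>
  have "\<exists>h. strict_mono_on {..<M} h \<and> h ` {..<M} \<subseteq> {k \<in> {B * j..<B * Suc j}. G (Suc n) k}" for n j
  proof -
    let ?S = "{k \<in> {B * j..<B * Suc j}. G (Suc n) k}"
    obtain h where h: "bij_betw h {..<card ?S} ?S" "strict_mono_on {..<card ?S} h"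
      by (rule ex_bij_betw_strict_mono_card[of ?S]) auto
    have "{..<M} \<subseteq> {..<card ?S}" using G[of j n] by auto
    then have "strict_mono_on {..<M} h" "h ` {..<M} \<subseteq> ?S"
      using monotone_on_subset[OF h(2)] image_mono[of "{..<M}" "{..<card ?S}" h] bij_betw_imp_surj_on[OF h(1)]
      by auto
    then show ?thesis by blast
  qed
  then have "\<exists>\<sigma>. \<forall>n j. strict_mono_on {..<M} (\<sigma> n j) \<and>
      \<sigma> n j ` {..<M} \<subseteq> {k \<in> {B * j..<B * Suc j}. G (Suc n) k}"
    by (intro choice allI)
  then obtain \<sigma> where \<sigma>: "\<And>n j. strict_mono_on {..<M} (\<sigma> n j)"
    "\<And>n j. \<sigma> n j ` {..<M} \<subseteq> {k \<in> {B * j..<B * Suc j}. G (Suc n) k}"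
    by blast
  have child: "B * j \<le> \<sigma> n j i" "\<sigma> n j i < B * Suc j" "G (Suc n) (\<sigma> n j i)" if "i < M" for n j i
    using \<sigma>(2)[of n j] that by auto
  let ?J = "cantor_index M \<sigma>"
  have J_less: "?J n i < ?J n i'" if "i < i'" "i' < M ^ n" for n i i'
    using that
  proof (induction n arbitrary: i i')
    case (Suc n)
    have mod: "i mod M < M" "i' mod M < M" using M by auto
    show ?case
    proof (cases "i div M = i' div M")
      case True
      then have "i mod M < i' mod M"
        using Suc.prems(1) by (metis div_mult_mod_eq nat_add_left_cancel_less)
      then show ?thesis
        using True mod \<sigma>(1)[of n "?J n (i div M)"] by (auto simp: strict_mono_on_def)
    next
      case False
      then have "i div M < i' div M" using Suc.prems(1) by (meson div_le_mono le_neq_implies_less less_imp_le)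
      moreover have "i' div M < M ^ n" using Suc.prems(2) by (intro less_mult_imp_div_less) (simp add: mult.commute)
      ultimately have "Suc (?J n (i div M)) \<le> ?J n (i' div M)" using Suc.IH by (simp add: Suc_leI)
      then have "B * Suc (?J n (i div M)) \<le> B * ?J n (i' div M)" by (rule mult_le_mono2)
      then show ?thesis
        using child(2)[OF mod(1), of n "?J n (i div M)"] child(1)[OF mod(2), of "?J n (i' div M)" n] by simp
    qed
  qed simp
  have J_diff: "?J n i + d \<le> ?J n (i + d)" if "i + d < M ^ n" for n i d
    using that
  proof (induction d)
    case (Suc d)
    then show ?case using J_less[of "i + d" "i + Suc d" n] by simp
  qed simp
  define a where "a n t = nat \<lfloor>real M ^ n * t\<rfloor>" for n t
  have a_le: "real (a n t) \<le> real M ^ n * t" "real M ^ n * t < real (a n t) + 1" if "0 \<le> t" for n t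
    using that by (simp_all add: a_def)
  have a_less: "a n t < M ^ n" if "t \<in> {0..<1}" for n t
  proof -
    have "real (a n t) \<le> real M ^ n * t" using a_le that by simp
    also have "\<dots> < real M ^ n" using that M by simp
    finally show ?thesis by (simp flip: of_nat_power)
  qed
  have a_div: "a (Suc n) t div M = a n t" if "0 \<le> t" for n t
  proof -
    have "\<lfloor>real M ^ n * t\<rfloor> = \<lfloor>real M ^ Suc n * t / real_of_int (int M)\<rfloor>" using M by simp
    also have "\<dots> = \<lfloor>real M ^ Suc n * t\<rfloor> div int M" by (rule floor_divide_real_eq_div) simp
    finally show ?thesis using that by (simp add: a_def nat_div_distrib)
  qed
  define K where "K n t = ?J n (a n t)" for n t
  have K: "B * K n t \<le> K (Suc n) t" "K (Suc n) t < B * Suc (K n t)" "G (Suc n) (K (Suc n) t)" if "0 \<le> t" for n t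
    using child[where i = "a (Suc n) t mod M" and j = "K n t" and n = n] M a_div[OF that, of n] by (auto simp: K_def)
  have inc: "incseq (\<lambda>n. real (K n t) / real B ^ n)" if "0 \<le> t" for t
  proof (rule incseq_SucI)
    fix n
    have "real (B * K n t) \<le> real (K (Suc n) t)" using K[OF that] by (intro of_nat_mono)
    then show "real (K n t) / real B ^ n \<le> real (K (Suc n) t) / real B ^ Suc n"
      using B by (simp add: field_simps)
  qed
  have dec: "decseq (\<lambda>n. real (Suc (K n t)) / real B ^ n)" if "0 \<le> t" for t
  proof (rule decseq_SucI)
    fix n
    have "real (Suc (K (Suc n) t)) \<le> real (B * Suc (K n t))" using K[OF that] by (intro of_nat_mono Suc_leI)
    then have "real (Suc (K (Suc n) t)) / real B ^ Suc n \<le> real (B * Suc (K n t)) / real B ^ Suc n"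
      by (rule divide_right_mono) simp
    also have "\<dots> = real (Suc (K n t)) / real B ^ n" using B by (simp only: of_nat_mult) simp
    finally show "real (Suc (K (Suc n) t)) / real B ^ Suc n \<le> real (Suc (K n t)) / real B ^ n" .
  qed
  have le: "real (K n t) / real B ^ n \<le> real (Suc (K l t)) / real B ^ l" if "0 \<le> t" for n l t
  proof -
    have "real (K n t) / real B ^ n \<le> real (K (max n l) t) / real B ^ max n l"
      using incseqD[OF inc[OF that], of n "max n l"] by simp
    also have "\<dots> \<le> real (Suc (K (max n l) t)) / real B ^ max n l"
      by (intro divide_right_mono) auto
    also have "\<dots> \<le> real (Suc (K l t)) / real B ^ l"
      using decseqD[OF dec[OF that], of l "max n l"] by simp
    finally show ?thesis .
  qed
  \<comment> \<open>The intervals are nested, so the supremum of the left endpoints lies in all of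
    them.\<close>
  define f where "f t = (SUP n. real (K n t) / real B ^ n)" for t
  have f: "real (K n t) / real B ^ n \<le> f t" "f t \<le> real (Suc (K n t)) / real B ^ n" if "0 \<le> t" for n t
    unfolding f_def using le[OF that] by (auto intro!: cSUP_upper cSUP_least bdd_aboveI)
  have hoelder: "u - t \<le> 3 * real M * \<bar>f t - f u\<bar> powr s" if tu: "0 \<le> t" "t < u" "u < 1" for t u
  proof -
    have "\<exists>n. 3 / real M ^ n \<le> u - t"
    proof -
      obtain n where "3 / (u - t) < real M ^ n" using M real_arch_pow[of "real M"] by auto
      then have "3 / real M ^ n \<le> u - t" using tu M by (simp add: field_simps)
      then show ?thesis ..
    qed
    \<comment> \<open>At this level the addresses of \<open>t\<close> and \<open>u\<close> differ by
      at least \<open>2\<close>, so a whole interval of length \<open>1 / real B ^ n\<close>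
      separates \<open>f t\<close> from \<open>f u\<close>; minimality bounds \<open>u - t\<close>
      by \<open>3 * real M / real M ^ n\<close>.\<close>
    define n where "n = (LEAST n. 3 / real M ^ n \<le> u - t)"
    have n: "3 / real M ^ n \<le> u - t"
      unfolding n_def by (rule LeastI_ex) fact
    have "n \<noteq> 0" using n tu by (intro notI) simp
    then obtain l where l: "n = Suc l" using not0_implies_Suc by blast
    have "\<not> 3 / real M ^ l \<le> u - t"
      using not_less_Least[of l "\<lambda>n. 3 / real M ^ n \<le> u - t"] l by (simp add: n_def)
    then have "u - t < 3 * real M * (1 / real M ^ n)" using l M by (simp add: field_simps)
    have "3 \<le> real M ^ n * u - real M ^ n * t" using n M by (simp add: field_simps)
    then have "real (a n t) + 2 < real (a n u) + 1"
      using a_le[of t n] a_le[of u n] tu by linarith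
    then have "a n t + 2 \<le> a n u" by linarith
    then have "?J n (a n t) + (a n u - a n t) \<le> ?J n (a n t + (a n u - a n t))"
      using a_less[of u n] tu by (intro J_diff) auto
    then have "K n t + 2 \<le> K n u" using \<open>a n t + 2 \<le> a n u\<close> by (simp add: K_def)
    then have "(real (Suc (K n t)) + 1) / real B ^ n \<le> real (K n u) / real B ^ n"
      using B by (intro divide_right_mono) auto
    then have "1 / real B ^ n \<le> f u - f t"
      using f(2)[of t n] f(1)[of u n] tu by (simp add: add_divide_distrib)
    then have "(1 / real B ^ n) powr s \<le> \<bar>f t - f u\<bar> powr s"
      using s(1) B by (intro powr_mono2) auto
    moreover have "1 / real M ^ n \<le> (1 / real B ^ n) powr s"
    proof -
      have "(real B ^ n) powr s = (real B powr s) ^ n"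
        using B by (simp add: powr_powr mult.commute flip: powr_realpow)
      also have "\<dots> \<le> real M ^ n" using s(2) by (intro power_mono) auto
      finally show ?thesis using B by (simp add: powr_divide frac_le)
    qed
    ultimately have "3 * real M * (1 / real M ^ n) \<le> 3 * real M * \<bar>f t - f u\<bar> powr s"
      by (intro mult_left_mono) auto
    with \<open>u - t < 3 * real M * (1 / real M ^ n)\<close> show ?thesis by linarith
  qed
  show ?thesis
  proof (rule that[of f])
    show "\<exists>k. G (Suc n) k \<and> f t \<in> {real k / real B ^ Suc n..real (Suc k) / real B ^ Suc n}" if "t \<in> {0..<1}" for t n
      using K(3)[of t n] f[of t "Suc n"] that by (intro exI[of _ "K (Suc n) t"]) auto
    show "f t \<in> {0..1}" if "t \<in> {0..<1}" for t
      using f[of t 0] that by (auto simp: K_def)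
    show "\<bar>t - u\<bar> \<le> 3 * real M * \<bar>f t - f u\<bar> powr s" if "t \<in> {0..<1}" "u \<in> {0..<1}" for t u
    proof (cases t u rule: linorder_cases)
      case less
      then show ?thesis using hoelder[of t u] that by simp
    next
      case greater
      then show ?thesis using hoelder[of u t] that by (simp add: abs_minus_commute)
    qed simp
  qed
qed

section \<open>The dimension of the exceptional set\<close>

text \<open>The condition says that the closed cell \<open>k\<close> of length \<open>h\<close>
  meets the interval from \<open>u\<close> to \<open>v\<close>; such \<open>k\<close> are integers
  between \<open>u / h - 1\<close> and \<open>v / h\<close>.\<close>

lemma card_nat_cells_le:
  fixes u v h :: real
  assumes "0 < h" "u \<le> v"
  shows "finite {k::nat. u \<le> real (Suc k) * h \<and> real k * h \<le> v}" (is "finite ?Q")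
    "real (card {k::nat. u \<le> real (Suc k) * h \<and> real k * h \<le> v}) \<le> (v - u) / h + 2"
proof -
  have sub: "int ` ?Q \<subseteq> {\<lceil>u / h - 1\<rceil>..\<lfloor>v / h\<rfloor>}"
  proof (clarsimp simp del: ceiling_diff_one)
    fix k :: nat assume "u \<le> (1 + real k) * h" "real k * h \<le> v"
    then have "u / h \<le> 1 + real k" "real k \<le> v / h"
      using assms(1) by (simp_all add: pos_divide_le_eq pos_le_divide_eq)
    then have "u / h - 1 \<le> real_of_int (int k)" "real_of_int (int k) \<le> v / h" by simp_all
    then show "\<lceil>u / h - 1\<rceil> \<le> int k \<and> int k \<le> \<lfloor>v / h\<rfloor>"
      unfolding ceiling_le_iff le_floor_iff ..
  qed
  have inj: "inj_on int ?Q" by simp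
  show fin: "finite ?Q" by (rule inj_on_finite[OF inj sub]) simp
  have "card ?Q \<le> card {\<lceil>u / h - 1\<rceil>..\<lfloor>v / h\<rfloor>}" by (rule card_inj_on_le[OF inj sub]) simp
  also have "\<dots> = nat (\<lfloor>v / h\<rfloor> - \<lceil>u / h - 1\<rceil> + 1)" by simp
  finally have "real (card ?Q) \<le> max 0 (real_of_int (\<lfloor>v / h\<rfloor> - \<lceil>u / h - 1\<rceil> + 1))" by linarith
  moreover have "u / h \<le> v / h" using assms by (simp add: divide_right_mono)
  ultimately have "real (card ?Q) \<le> v / h - u / h + 2" by linarith
  then show "real (card ?Q) \<le> (v - u) / h + 2" by (simp add: diff_divide_distrib)
qed

text \<open>The weights telescope along the increasing points, and \<open>T\<close> pays for the
  last one. With \<open>w p = 1 / p\<close> this bounds the total length of the balls, with constant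
  \<open>w\<close> the number of points.\<close>

lemma sum_gaps_le:
  fixes z w :: "nat \<Rightarrow> real"
  assumes "finite S" "L \<le> R" "0 \<le> T"
    and "\<And>p. p \<in> S \<Longrightarrow> L \<le> z p" "\<And>p. p \<in> S \<Longrightarrow> z p \<le> R" "\<And>p. p \<in> S \<Longrightarrow> w p \<le> T"
    and "\<And>p q. p \<in> S \<Longrightarrow> q \<in> S \<Longrightarrow> p < q \<Longrightarrow> z p + w p \<le> z q"
  shows "sum w S \<le> R - L + T"
proof (cases "S = {}")
  case False
  have "sum w S \<le> z (Max S) - L + w (Max S)"
    using assms(1) False assms(4,7)
  proof (induction S rule: finite_linorder_max_induct)
    case (insert b A)
    show ?case
    proof (cases "A = {}")
      case False
      have "Max (insert b A) = b"
        using insert.hyps(1,2) by (intro Max_eqI) (auto intro: less_imp_le)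
      moreover have "sum w A \<le> z (Max A) - L + w (Max A)"
        using False by (intro insert.IH insert.prems) auto
      moreover have "z (Max A) + w (Max A) \<le> z b"
        using insert.hyps False by (intro insert.prems(3)) auto
      moreover have "b \<notin> A" using insert.hyps(2) by auto
      ultimately show ?thesis using insert.hyps(1) by simp
    qed (use insert.prems in simp)
  qed simp
  also have "\<dots> \<le> R - L + T"
    using assms(5,6)[of "Max S"] Max_in[OF assms(1) False] by simp
  finally show ?thesis .
qed (use assms in simp)

text \<open>The primes between \<open>2\<^sup>a\<close> and \<open>2\<^sup>a\<^sup>+\<^sup>m\<close> have too small a reciprocal sum for two restarts; so they
  split into two pieces on which the points \<open>greedy p / p\<close> increase with gaps at least \<open>1 / p\<close>.\<close>

lemma greedy_two_runs:
  assumes "4 * m < a"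
  obtains r where "\<And>p q. prime p \<Longrightarrow> prime q \<Longrightarrow> 2 ^ a < p \<Longrightarrow> p < q \<Longrightarrow> q \<le> 2 ^ (a + m) \<Longrightarrow>
    q < r \<or> r \<le> p \<Longrightarrow> real_of_int (greedy p) / real p + 1 / real p \<le> real_of_int (greedy q) / real q"
proof -
  define W where "W = {p::nat. prime p \<and> 2 ^ a < p \<and> p \<le> 2 ^ (a + m)}"
  have finW: "finite W" by (rule finite_subset[of _ "{..2 ^ (a + m)}"]) (auto simp: W_def)
  have unique: "\<not> p < q" if "p \<in> W" "q \<in> W" "greedy_pos p = 0" "greedy_pos q = 0" for p q
  proof
    assume "p < q"
    then have "1 \<le> (\<Sum>u | prime u \<and> p \<le> u \<and> u < q. 2 / real u)"
      using that by (intro sum_between_restarts) (auto simp: W_def)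
    also have "\<dots> \<le> (\<Sum>u\<in>W. 2 / real u)"
      using that finW by (intro sum_mono2) (auto simp: W_def)
    also have "\<dots> = 2 * (\<Sum>u\<in>W. 1 / real u)" by (simp add: sum_distrib_left)
    also have "\<dots> \<le> 2 * (2 * real m / real a)"
      unfolding W_def using assms by (intro mult_left_mono sum_prime_reciprocals_le) auto
    also have "\<dots> < 1" using assms by (simp add: field_simps flip: of_nat_mult)
    finally show False by simp
  qed
  \<comment> \<open>The only restart in the range opens the second piece. If there is none, the
    default \<open>0\<close> makes \<open>r \<le> p\<close> always true, and there is just one
    piece.\<close>
  define r where "r = (if \<exists>u\<in>W. greedy_pos u = 0 then SOME u. u \<in> W \<and> greedy_pos u = 0 else 0)"
  have r: "u = r" if "u \<in> W" "greedy_pos u = 0" for u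
  proof -
    have "r \<in> W \<and> greedy_pos r = 0" unfolding r_def using that someI_ex[of "\<lambda>u. u \<in> W \<and> greedy_pos u = 0"] by auto
    then show ?thesis using unique[of u r] unique[of r u] that by (meson linorder_neqE_nat)
  qed
  show ?thesis
  proof (rule that[of r])
    fix p q :: nat
    assume pq: "prime p" "prime q" "2 ^ a < p" "p < q" "q \<le> 2 ^ (a + m)" "q < r \<or> r \<le> p"
    show "real_of_int (greedy p) / real p + 1 / real p \<le> real_of_int (greedy q) / real q"
    proof (rule greedy_spacing)
      fix u assume u: "prime u" "p < u" "u \<le> q"
      then have "u \<in> W" using pq by (simp only: W_def mem_Collect_eq) (metis le_trans less_trans)
      then show "greedy_pos u \<noteq> 0" using r[of u] pq u by auto
    qed (use pq in auto)
  qed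
qed

text \<open>A point spoils up to two cells however small \<open>c\<close> is; since cells are \<open>32 = 2\<^sup>5\<close> times shorter
  than the smallest gap \<open>1 / 2\<^sup>a\<^sup>+\<^sup>m\<close> in a run, these amount to a small proportion of all cells.
  The balls have radius \<open>c / p \<le> c / 2\<^sup>a\<close>, where \<open>1 / 2\<^sup>a\<close> is \<open>32\<close> times the length of the parent
  interval; hence the bound \<open>1 / 32\<^sup>2\<close> on \<open>c\<close>.\<close>

lemma card_surviving_cells:
  fixes a m j :: nat and c h :: real
  assumes m: "6 \<le> m" "4 * m < a" and c: "0 < c" "c \<le> 1 / 1024" and h: "h = 1 / 2 ^ (a + m + 5)"
  shows "2 ^ (m - 1) \<le> card {k \<in> {2 ^ m * j..<2 ^ m * Suc j}.
    \<forall>p. prime p \<and> 2 ^ a < p \<and> p \<le> 2 ^ (a + m) \<longrightarrow>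
      (\<forall>x\<in>{real k * h..real (Suc k) * h}. c / real p < \<bar>x - real_of_int (greedy p) / real p\<bar>)}"
    (is "_ \<le> card ?good")
proof -
  define B :: real where "B = 2 ^ m"
  define z where "z p = real_of_int (greedy p) / real p" for p
  define W where "W = {p::nat. prime p \<and> 2 ^ a < p \<and> p \<le> 2 ^ (a + m)}"
  define Q where "Q p = {k::nat. z p - c / real p \<le> real (Suc k) * h \<and> real k * h \<le> z p + c / real p}" for p
  define cells where "cells = {2 ^ m * j..<2 ^ m * Suc j}"
  \<comment> \<open>\<open>Q p\<close> collects all cells touched by the ball of \<open>p\<close>,
    not only children of \<open>j\<close>; \<open>H\<close> keeps the primes whose ball touches such
    a child.\<close>
  define H where "H = {p \<in> W. cells \<inter> Q p \<noteq> {}}"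
  have h0: "0 < h" and Bh: "1 / 2 ^ a = 32 * (B * h)" and hB: "1 / 2 ^ (a + m) = 32 * h"
    by (simp_all add: h B_def power_add)
  have B64: "64 \<le> B"
    using power_increasing[of 6 m "2::real"] m(1) by (simp add: B_def)
  have finW: "finite W" by (rule finite_subset[of _ "{..2 ^ (a + m)}"]) (auto simp: W_def)
  then have finH: "finite H" by (simp add: H_def)
  have W: "1 / real p \<le> 1 / 2 ^ a" "1 / 2 ^ (a + m) \<le> 1 / real p" "0 < p" if "p \<in> W" for p
  proof -
    have p: "2 ^ a < p" "p \<le> 2 ^ (a + m)" "0 < p" using that prime_gt_0_nat by (auto simp: W_def)
    then have "real (2 ^ a) \<le> real p" "real p \<le> real (2 ^ (a + m))" by (simp_all only: of_nat_le_iff)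
    then have "2 ^ a \<le> real p" "real p \<le> 2 ^ (a + m)" by simp_all
    with p show "1 / real p \<le> 1 / 2 ^ a" "1 / 2 ^ (a + m) \<le> 1 / real p" "0 < p"
      by (auto intro!: frac_le)
  qed
  have cardQ: "finite (Q p)" "real (card (Q p)) \<le> 2 * c / h * (1 / real p) + 2" for p
  proof -
    have "0 \<le> c / real p" using c by simp
    then have "z p - c / real p \<le> z p + c / real p" by linarith
    from card_nat_cells_le[OF h0 this]
    show "finite (Q p)" "real (card (Q p)) \<le> 2 * c / h * (1 / real p) + 2"
      unfolding Q_def by (simp_all add: mult.commute)
  qed
  \<comment> \<open>The parent interval, enlarged on both sides by a bound for all radii, contains
    the centres of all balls that touch it.\<close>
  define L R where "L = B * real j * h - c / 2 ^ a" and "R = B * real (Suc j) * h + c / 2 ^ a"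
  have RL: "R - L \<le> 17 / 16 * (B * h)"
  proof -
    have "R - L = B * h + 2 * c * (1 / 2 ^ a)" by (simp add: R_def L_def algebra_simps)
    also have "\<dots> = B * h + 64 * c * (B * h)" by (simp only: Bh)
    also have "64 * c * (B * h) \<le> 1 / 16 * (B * h)" using c h0 B64 by (intro mult_right_mono) auto
    finally show ?thesis by simp
  qed
  have "L \<le> R" using h0 B64 c by (simp add: L_def R_def algebra_simps)
  have z: "L \<le> z p" "z p \<le> R" if "p \<in> H" for p
  proof -
    from that obtain k where k: "k \<in> cells" "k \<in> Q p" and p: "p \<in> W" by (auto simp: H_def)
    have "c * (1 / real p) \<le> c * (1 / 2 ^ a)" using W(1)[OF p] c by (intro mult_left_mono) auto
    then have cp: "c / real p \<le> c / 2 ^ a" by simp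
    have "real (2 ^ m * j) \<le> real k" "real (Suc k) \<le> real (2 ^ m * Suc j)"
      using k(1) unfolding cells_def by (auto simp only: of_nat_le_iff atLeastLessThan_iff Suc_le_eq)
    then have "B * real j * h \<le> real k * h" "real (Suc k) * h \<le> B * real (Suc j) * h"
      using h0 by (auto intro!: mult_right_mono simp only: B_def of_nat_mult of_nat_power of_nat_numeral)
    then show "L \<le> z p" "z p \<le> R" using k(2) cp unfolding L_def R_def Q_def mem_Collect_eq by linarith+
  qed
  \<comment> \<open>The lengths of the balls account for at most \<open>68 / 1024 * B\<close> cells,
    and the two extra cells per ball for at most \<open>17 / 256 * B + 2\<close>. The sum is at most
    \<open>B / 4\<close> because \<open>64 \<le> B\<close>.\<close>
  have run: "(\<Sum>p\<in>S. real (card (Q p))) \<le> B / 4"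
    if S: "S \<subseteq> H" and gap: "\<And>p q. p \<in> S \<Longrightarrow> q \<in> S \<Longrightarrow> p < q \<Longrightarrow> z p + 1 / real p \<le> z q" for S
  proof -
    have fin: "finite S" using S finH finite_subset by blast
    have SW: "p \<in> W" if "p \<in> S" for p using S that by (auto simp: H_def)
    have "(\<Sum>p\<in>S. 1 / real p) \<le> R - L + 1 / 2 ^ a"
      using fin \<open>L \<le> R\<close> z S W(1)[OF SW] gap by (intro sum_gaps_le[where z = z]) auto
    also have "\<dots> \<le> 34 * (B * h)" using RL Bh mult_pos_pos[of B h] h0 B64 by linarith
    finally have "2 * c / h * (\<Sum>p\<in>S. 1 / real p) \<le> 2 * c / h * (34 * (B * h))"
      using c h0 by (intro mult_left_mono) auto
    also have "\<dots> = 68 * (c * B)" using h0 by simp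
    also have "\<dots> \<le> 68 * (1 / 1024 * B)" using c B64 by (intro mult_left_mono mult_right_mono) auto
    finally have s1: "2 * c / h * (\<Sum>p\<in>S. 1 / real p) \<le> 68 * (1 / 1024 * B)" .
    \<comment> \<open>Constant weights count the points: every gap is at least
      \<open>1 / 2 ^ (a + m)\<close>, which is \<open>32 * h\<close>.\<close>
    have "(\<Sum>p\<in>S. 32 * h) \<le> R - L + 32 * h"
    proof (rule sum_gaps_le[where z = z])
      show "z p + 32 * h \<le> z q" if "p \<in> S" "q \<in> S" "p < q" for p q
        using gap[OF that] W(2)[OF SW[OF that(1)]] hB by linarith
    qed (use fin \<open>L \<le> R\<close> z S h0 in auto)
    then have "real (card S) * (32 * h) \<le> (17 / 512 * B + 1) * (32 * h)"
      using RL by (simp add: algebra_simps)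
    then have s2: "real (card S) \<le> 17 / 512 * B + 1" using h0 by simp
    have "(\<Sum>p\<in>S. real (card (Q p))) \<le> (\<Sum>p\<in>S. 2 * c / h * (1 / real p) + 2)"
      by (intro sum_mono cardQ)
    also have "\<dots> = 2 * c / h * (\<Sum>p\<in>S. 1 / real p) + 2 * real (card S)"
      by (simp only: sum.distrib sum_distrib_left sum_constant mult.commute[of _ 2])
    also have "\<dots> \<le> B / 4" using s1 s2 B64 by linarith
    finally show ?thesis .
  qed
  obtain r where r: "\<And>p q. prime p \<Longrightarrow> prime q \<Longrightarrow> 2 ^ a < p \<Longrightarrow> p < q \<Longrightarrow> q \<le> 2 ^ (a + m) \<Longrightarrow>
    q < r \<or> r \<le> p \<Longrightarrow> z p + 1 / real p \<le> z q"
    using greedy_two_runs[OF m(2)] unfolding z_def by metis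
  have "(\<Sum>p\<in>H. real (card (Q p))) = (\<Sum>p\<in>{p\<in>H. p < r}. real (card (Q p))) + (\<Sum>p\<in>{p\<in>H. r \<le> p}. real (card (Q p)))"
    using finH by (subst sum.union_disjoint[symmetric]) (auto intro!: sum.cong)
  also have "\<dots> \<le> B / 4 + B / 4"
    by (intro add_mono run) (auto intro!: r simp: H_def W_def)
  finally have sumH: "(\<Sum>p\<in>H. real (card (Q p))) \<le> B / 2" by simp
  have "cells - ?good \<subseteq> (\<Union>p\<in>H. Q p)"
  proof
    fix k assume k: "k \<in> cells - ?good"
    then obtain p x where p: "p \<in> W" and x: "real k * h \<le> x" "x \<le> real (Suc k) * h" "\<bar>x - z p\<bar> \<le> c / real p"
      by (auto simp: cells_def W_def z_def not_less)
    have "k \<in> Q p" unfolding Q_def mem_Collect_eq using x by linarith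
    then show "k \<in> (\<Union>p\<in>H. Q p)" using p k by (auto simp: H_def)
  qed
  then have "card (cells - ?good) \<le> card (\<Union>p\<in>H. Q p)"
    using finH cardQ(1) by (intro card_mono) auto
  also have "\<dots> \<le> (\<Sum>p\<in>H. card (Q p))" using finH by (rule card_UN_le)
  finally have "real (card (cells - ?good)) \<le> real (\<Sum>p\<in>H. card (Q p))" by (rule of_nat_mono)
  then have bad: "real (card (cells - ?good)) \<le> B / 2" using sumH by simp
  have "card (cells - ?good) = card cells - card ?good"
    by (intro card_Diff_subset) (auto simp: cells_def)
  moreover have "card cells = 2 ^ m" by (simp add: cells_def)
  ultimately have "2 ^ m \<le> card (cells - ?good) + card ?good" by linarith
  then have "real (2 ^ m) \<le> real (card (cells - ?good) + card ?good)" by (rule of_nat_mono)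
  then have "B / 2 \<le> real (card ?good)" using bad by (simp add: B_def)
  moreover have "B = 2 * 2 ^ (m - 1)" using m(1) by (simp add: B_def flip: power_Suc)
  ultimately have "real (2 ^ (m - 1)) \<le> real (card ?good)" by simp
  then show ?thesis by (simp only: of_nat_le_iff)
qed

text \<open>The base \<open>2 ^ m\<close> has to grow as \<open>s\<close> approaches
  \<open>1\<close>, whereas \<open>c\<close> stays fixed; this is why the bound on \<open>c\<close>
  in \<open>card_surviving_cells\<close> does not depend on \<open>m\<close>.\<close>

lemma hausdorff_dim_Diff_prime_approx_greedy:
  assumes c: "0 < c" "c \<le> 1 / 1024"
  shows "hausdorff_dim ({0..1} - prime_approx greedy c) = 1"
proof -
  let ?E = "{0..1} - prime_approx greedy c"
  have *: "\<exists>g C. g ` {0..<1} \<subseteq> ?E \<and> 0 < C \<and>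
      (\<forall>t\<in>{0..<1}. \<forall>u\<in>{0..<1}. \<bar>t - u\<bar> \<le> C * dist (g t) (g u) powr s)"
    if s: "0 < s" "s < 1" for s :: real
  proof -
    \<comment> \<open>\<open>1 / (1 - s) \<le> m\<close> means \<open>m * s \<le> m - 1\<close>,
      that is, \<open>B powr s \<le> B / 2\<close>. The minimum \<open>6\<close> is required by
      \<open>card_surviving_cells\<close>.\<close>
    obtain m0 :: nat where m0: "1 / (1 - s) < real m0" using reals_Archimedean2 by blast
    define m where "m = max 6 m0"
    have m: "6 \<le> m" "m0 \<le> m" by (auto simp: m_def)
    define B M :: nat where "B = 2 ^ m" and "M = 2 ^ (m - 1)"
    have B: "2 \<le> B"
      using power_increasing[of 1 m "2::nat"] m by (simp add: B_def)
    have "1 / (1 - s) \<le> real m" using m m0 by linarith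
    then have "1 \<le> real m * (1 - s)" using s by (simp add: pos_divide_le_eq)
    then have "real m * s \<le> real (m - 1)" using m by (simp add: of_nat_diff algebra_simps)
    then have "2 powr (real m * s) \<le> 2 powr real (m - 1)" by simp
    moreover have "real B powr s = 2 powr (real m * s)"
      by (simp add: B_def powr_powr flip: powr_realpow)
    ultimately have BM: "real B powr s \<le> real M" by (simp add: M_def powr_realpow)
    \<comment> \<open>Chosen so that \<open>1 / real B ^ (n + 5)\<close> is the cell length
      \<open>1 / 2 ^ (a n + m + 5)\<close> of \<open>card_surviving_cells\<close>. The shift by five
      levels ensures \<open>4 * m < a n\<close> from \<open>n = 1\<close> on.\<close>
    define a where "a n = m * (n + 4) - 5" for n
    define G where "G n k \<longleftrightarrow> (\<forall>p. prime p \<and> 2 ^ a n < p \<and> p \<le> 2 ^ (a n + m) \<longrightarrow>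
      (\<forall>x\<in>{real k * (1 / real B ^ (n + 5))..real (Suc k) * (1 / real B ^ (n + 5))}.
        c / real p < \<bar>x - real_of_int (greedy p) / real p\<bar>))" for n k
    have a: "a n + m + 5 = m * (n + 5)" for n
    proof -
      have "m * 1 \<le> m * (n + 4)" by (intro mult_le_mono2) simp
      then have "5 \<le> m * (n + 4)" using m by linarith
      then show ?thesis by (simp add: a_def algebra_simps)
    qed
    have surv: "M \<le> card {k \<in> {B * j..<B * Suc j}. G (Suc n) k}" for n j
      unfolding B_def M_def G_def
    proof (rule card_surviving_cells[OF m(1) _ c])
      show "4 * m < a (Suc n)"
      proof -
        have "m * 6 \<le> m * (Suc n + 5)" by (intro mult_le_mono2) simp
        then show ?thesis using a[of "Suc n"] m by linarith
      qed
      show "1 / real (2 ^ m) ^ (Suc n + 5) = 1 / 2 ^ (a (Suc n) + m + 5)"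
        by (simp only: a of_nat_power of_nat_numeral power_mult)
    qed
    obtain f where f: "\<And>t n. t \<in> {0..<1} \<Longrightarrow> \<exists>k. G (Suc n) k \<and>
          f t \<in> {real k / real B ^ Suc n..real (Suc k) / real B ^ Suc n}"
      "\<And>t. t \<in> {0..<1} \<Longrightarrow> f t \<in> {0..1}"
      "\<And>t u. t \<in> {0..<1} \<Longrightarrow> u \<in> {0..<1} \<Longrightarrow> \<bar>t - u\<bar> \<le> 3 * real M * \<bar>f t - f u\<bar> powr s"
      by (rule cantor_tree_hoelder[where G = G, OF B s(1) BM surv]) blast
    \<comment> \<open>The tree lives on the whole unit interval; scaling turns its intervals of
      level \<open>n\<close> into cells of length \<open>1 / real B ^ (n + 5)\<close>.\<close>
    define g where "g t = f t / real B ^ 5" for t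
    have B5: "1 \<le> real B ^ 5" using B by (intro one_le_power) simp
    have "g t \<in> ?E" if t: "t \<in> {0..<1}" for t
    proof -
      have avoid: "c / real p < \<bar>g t - real_of_int (greedy p) / real p\<bar>" if p: "prime p" "2 ^ a 1 < p" for p
      proof -
        \<comment> \<open>Since \<open>a (Suc k) = a k + m\<close>, the ranges of primes treated at
          successive levels adjoin and exhaust the primes above \<open>2 ^ a 1\<close>;
          \<open>Suc n\<close> is the level that treats \<open>p\<close>.\<close>
        define n where "n = (LEAST n. p \<le> 2 ^ a (Suc (Suc n)))"
        have aS: "a (Suc k) = a k + m" for k using a[of k] a[of "Suc k"] by (simp add: algebra_simps)
        have "k \<le> a k" for k
        proof (induction k)
          case (Suc k)
          then show ?case using aS[of k] m by linarith
        qed simp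
        then have "p \<le> 2 ^ a (Suc (Suc p))"
          using less_exp[of p] power_increasing[of p "a (Suc (Suc p))" "2::nat"] by (meson Suc_leD le_trans less_imp_le one_le_numeral order_refl)
        then have n: "p \<le> 2 ^ a (Suc (Suc n))"
          unfolding n_def by (rule LeastI)
        have low: "2 ^ a (Suc n) < p"
        proof (cases n)
          case (Suc k)
          then have "\<not> p \<le> 2 ^ a (Suc (Suc k))"
            using not_less_Least[of k "\<lambda>n. p \<le> 2 ^ a (Suc (Suc n))"] by (simp add: n_def)
          then show ?thesis using Suc by simp
        qed (use p in simp)
        obtain k where k: "G (Suc n) k" "f t \<in> {real k / real B ^ Suc n..real (Suc k) / real B ^ Suc n}"
          using f(1)[OF t] by blast
        have "g t \<in> {real k * (1 / real B ^ (Suc n + 5))..real (Suc k) * (1 / real B ^ (Suc n + 5))}"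
          using k(2) B5 divide_right_mono[of _ _ "real B ^ 5"] unfolding g_def power_add by fastforce
        then show ?thesis using k(1) p low n unfolding G_def aS[of "Suc n"] by blast
      qed
      have "{p. prime p \<and> \<bar>g t - real_of_int (greedy p) / real p\<bar> \<le> c / real p} \<subseteq> {..2 ^ a 1}"
      proof
        fix p assume "p \<in> {p. prime p \<and> \<bar>g t - real_of_int (greedy p) / real p\<bar> \<le> c / real p}"
        then have "\<not> 2 ^ a 1 < p" using avoid[of p] by auto
        then show "p \<in> {..2 ^ a 1}" by simp
      qed
      then have "finite {p. prime p \<and> \<bar>g t - real_of_int (greedy p) / real p\<bar> \<le> c / real p}"
        using finite_subset by blast
      moreover have "0 \<le> f t" "f t \<le> real B ^ 5"
        using f(2)[OF t] B5 by (simp, meson atLeastAtMost_iff order_trans)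
      then have "g t \<in> {0..1}" using B by (simp add: g_def)
      ultimately show ?thesis by (simp add: prime_approx_def)
    qed
    moreover have "\<bar>t - u\<bar> \<le> 3 * real M * (real B ^ 5) powr s * dist (g t) (g u) powr s"
      if "t \<in> {0..<1}" "u \<in> {0..<1}" for t u
    proof -
      have "\<bar>f t - f u\<bar> = real B ^ 5 * dist (g t) (g u)"
        using B5 B by (simp add: g_def dist_real_def diff_divide_distrib[symmetric])
      then have "\<bar>f t - f u\<bar> powr s = (real B ^ 5) powr s * dist (g t) (g u) powr s"
        by (simp add: powr_mult)
      then show ?thesis using f(3)[OF that] by (simp add: mult.assoc)
    qed
    moreover have "0 < 3 * real M * (real B ^ 5) powr s"
      using B by (simp add: M_def)
    ultimately show ?thesis
      by (intro exI[of _ g] exI[of _ "3 * real M * (real B ^ 5) powr s"]) auto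
  qed
  show ?thesis
  proof (rule hausdorff_dim_eq_1)
    show "0 < hausdorff_measure s ?E" if "0 < s" "s < 1" for s
      using *[OF that] that(1) by (auto intro: hausdorff_measure_pos)
    have "(0::real) \<in> {0..<1}" by simp
    then show "?E \<noteq> {}" using *[of "1/2"] by fastforce
  qed auto
qed

theorem theorem1p3:
  "emeasure (lebesgue_on {0..1}) (prime_approx_all greedy) = 1 \<and>
   (\<forall>c>2. prime_approx greedy c = {0..1}) \<and>
   (\<exists>c0>0. \<forall>c. 0 < c \<and> c < c0 \<longrightarrow> hausdorff_dim ({0..1} - prime_approx greedy c) = 1)"
proof (intro conjI)
  show "emeasure (lebesgue_on {0..1}) (prime_approx_all greedy) = 1"
    by (rule emeasure_prime_approx_all_greedy)
  show "\<forall>c>2. prime_approx greedy c = {0..1}"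
    by (simp add: prime_approx_greedy_eq_unit_interval)
  show "\<exists>c0>0. \<forall>c. 0 < c \<and> c < c0 \<longrightarrow> hausdorff_dim ({0..1} - prime_approx greedy c) = 1"
    by (intro exI[of _ "1 / 1024"]) (auto intro: hausdorff_dim_Diff_prime_approx_greedy)
qed

end
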